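(* Assume $r$ is a Cohen real over $V$ or a random real over $V$. Then $r$ defines $\mathbb{Z}$, in the sense that the set of integers $\mathbb{Z}$ is definable in the structure $(\mathbb{R}^{V[r]}, +, \cdot, <, 0, 1, r)$, where $r$ is considered as a unary predicate.
   Context: $\mathbb{R}^{V[r]}$ is the set of real numbers of the generic extension $V[r]$. The real $r \in 2^\omega$ is identified with the subset of $\omega$ of which it is the characteristic function, and this subset of $\omega \subseteq \mathbb{R}^{V[r]}$ interprets the unary predicate. "Definable" means first-order definable in the structure (parameters allowed). Cohen forcing is the set of functions $p : n \to 2$, $n\in\omega$, ordered by reverse inclusion; random forcing is the algebra of Borel subsets of $2^\omega$ modulo sets null for the standard product measure, ordered by inclusion modulo null sets (forcing conditions are the nonzero classes). The real $r$ is Cohen (respectively random) over $V$ if it is the generic real over $V$ for Cohen (respectively random) forcing; equivalently, $r$ belongs to no meager (respectively null) Borel set coded in $V$. *)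

theory Defs
  imports "HOL-Probability.Probability" "HOL-Library.Nat_Bijection"
begin

section \<open>Models of set theory\<close>

text \<open>
  A relation \<open>E :: 'v \<Rightarrow> 'v \<Rightarrow> bool\<close> is read as membership: \<open>E y x\<close> means \<open>y \<in> x\<close>.
  Subclasses of the universe are HOL sets \<open>M :: 'v set\<close>.
\<close>

datatype set_fm =
    SMem nat nat | SEq nat nat | SNot set_fm | SAnd set_fm set_fm | SEx nat set_fm

primrec set_sat :: "('v \<Rightarrow> 'v \<Rightarrow> bool) \<Rightarrow> 'v set \<Rightarrow> (nat \<Rightarrow> 'v) \<Rightarrow> set_fm \<Rightarrow> bool" where
  "set_sat E M e (SMem i j) \<longleftrightarrow> E (e i) (e j)"
| "set_sat E M e (SEq i j) \<longleftrightarrow> e i = e j"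
| "set_sat E M e (SNot \<phi>) \<longleftrightarrow> \<not> set_sat E M e \<phi>"
| "set_sat E M e (SAnd \<phi> \<psi>) \<longleftrightarrow> set_sat E M e \<phi> \<and> set_sat E M e \<psi>"
| "set_sat E M e (SEx i \<phi>) \<longleftrightarrow> (\<exists>x\<in>M. set_sat E M (e(i := x)) \<phi>)"

text \<open>
  The ZFC axioms relativized to \<open>M\<close>. The two schemas range over first-order formulas of the
  language of set theory with parameters from \<open>M\<close> (given by the assignment \<open>e\<close>).
\<close>

definition ZFC_model :: "('v \<Rightarrow> 'v \<Rightarrow> bool) \<Rightarrow> 'v set \<Rightarrow> bool" where
  "ZFC_model E M \<longleftrightarrow>
     \<comment> \<open>extensionality\<close>
     (\<forall>x\<in>M. \<forall>y\<in>M. (\<forall>z\<in>M. E z x \<longleftrightarrow> E z y) \<longrightarrow> x = y) \<and>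
     \<comment> \<open>foundation\<close>
     (\<forall>x\<in>M. (\<exists>y\<in>M. E y x) \<longrightarrow> (\<exists>y\<in>M. E y x \<and> \<not> (\<exists>z\<in>M. E z x \<and> E z y))) \<and>
     \<comment> \<open>pairing\<close>
     (\<forall>x\<in>M. \<forall>y\<in>M. \<exists>z\<in>M. \<forall>w\<in>M. E w z \<longleftrightarrow> w = x \<or> w = y) \<and>
     \<comment> \<open>union\<close>
     (\<forall>x\<in>M. \<exists>u\<in>M. \<forall>w\<in>M. E w u \<longleftrightarrow> (\<exists>y\<in>M. E y x \<and> E w y)) \<and>
     \<comment> \<open>power set\<close>
     (\<forall>x\<in>M. \<exists>p\<in>M. \<forall>w\<in>M. E w p \<longleftrightarrow> (\<forall>z\<in>M. E z w \<longrightarrow> E z x)) \<and>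
     \<comment> \<open>infinity\<close>
     (\<exists>x\<in>M. (\<exists>o0\<in>M. E o0 x \<and> (\<forall>z\<in>M. \<not> E z o0)) \<and>
        (\<forall>y\<in>M. E y x \<longrightarrow> (\<exists>s\<in>M. E s x \<and> (\<forall>z\<in>M. E z s \<longleftrightarrow> E z y \<or> z = y)))) \<and>
     \<comment> \<open>separation\<close>
     (\<forall>\<phi> e. range e \<subseteq> M \<longrightarrow>
        (\<forall>x\<in>M. \<exists>y\<in>M. \<forall>z\<in>M. E z y \<longleftrightarrow> E z x \<and> set_sat E M (e(0 := z)) \<phi>)) \<and>
     \<comment> \<open>replacement\<close>
     (\<forall>\<phi> e. range e \<subseteq> M \<longrightarrow>
        (\<forall>a\<in>M. (\<forall>x\<in>M. E x a \<longrightarrow> (\<exists>!y. y \<in> M \<and> set_sat E M (e(0 := x, 1 := y)) \<phi>)) \<longrightarrow>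
           (\<exists>b\<in>M. \<forall>y\<in>M. E y b \<longleftrightarrow>
              (\<exists>x\<in>M. E x a \<and> set_sat E M (e(0 := x, 1 := y)) \<phi>)))) \<and>
     \<comment> \<open>choice: a family of nonempty, pairwise disjoint sets has a transversal\<close>
     (\<forall>x\<in>M. (\<forall>y\<in>M. E y x \<longrightarrow> (\<exists>z\<in>M. E z y)) \<and>
        (\<forall>y\<in>M. \<forall>y'\<in>M. E y x \<and> E y' x \<and> y \<noteq> y' \<longrightarrow> \<not> (\<exists>z\<in>M. E z y \<and> E z y')) \<longrightarrow>
        (\<exists>c\<in>M. \<forall>y\<in>M. E y x \<longrightarrow> (\<exists>!z. z \<in> M \<and> E z y \<and> E z c)))"

definition elts :: "('v \<Rightarrow> 'v \<Rightarrow> bool) \<Rightarrow> 'v \<Rightarrow> 'v set" where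
  "elts E x = {y. E y x}"

definition extensional_mem :: "('v \<Rightarrow> 'v \<Rightarrow> bool) \<Rightarrow> bool" where
  "extensional_mem E \<longleftrightarrow> (\<forall>x y. elts E x = elts E y \<longrightarrow> x = y)"

definition transitive_class :: "('v \<Rightarrow> 'v \<Rightarrow> bool) \<Rightarrow> 'v set \<Rightarrow> bool" where
  "transitive_class E M \<longleftrightarrow> (\<forall>x\<in>M. elts E x \<subseteq> M)"


section \<open>Natural numbers, pairs and functions as sets\<close>

primrec is_num :: "('v \<Rightarrow> 'v \<Rightarrow> bool) \<Rightarrow> nat \<Rightarrow> 'v \<Rightarrow> bool" where
  "is_num E 0 x \<longleftrightarrow> elts E x = {}"
| "is_num E (Suc n) x \<longleftrightarrow> (\<exists>y. is_num E n y \<and> elts E x = insert y (elts E y))"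

definition is_pair :: "('v \<Rightarrow> 'v \<Rightarrow> bool) \<Rightarrow> 'v \<Rightarrow> 'v \<Rightarrow> 'v \<Rightarrow> bool" where
  "is_pair E a b p \<longleftrightarrow> (\<exists>u v. elts E u = {a} \<and> elts E v = {a, b} \<and> elts E p = {u, v})"

text \<open>The class of sets \<open>(i, j)\<close>, for \<open>f i = Some j\<close>: the graph of a partial function on \<open>\<omega>\<close>.\<close>

definition graph_class :: "('v \<Rightarrow> 'v \<Rightarrow> bool) \<Rightarrow> (nat \<Rightarrow> nat option) \<Rightarrow> 'v set" where
  "graph_class E f =
     {p. \<exists>i j a b. f i = Some j \<and> is_num E i a \<and> is_num E j b \<and> is_pair E a b p}"


section \<open>Generic filters and generic extensions\<close>

text \<open>
  Forcing conditions are elements of the universe; \<open>le p q\<close> means that \<open>p\<close> is stronger than \<open>q\<close>.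
  The dense sets that \<open>G\<close> has to meet are the sets \<open>d \<in> V\<close> such that \<open>d \<inter> P\<close> is dense in \<open>P\<close>.
  As \<open>P\<close> is a set of \<open>V\<close> in the cases below, these amount to the dense subsets \<open>d \<subseteq> P\<close> in \<open>V\<close>.
\<close>

definition generic_filter ::
  "('v \<Rightarrow> 'v \<Rightarrow> bool) \<Rightarrow> 'v set \<Rightarrow> 'v set \<Rightarrow> ('v \<Rightarrow> 'v \<Rightarrow> bool) \<Rightarrow> 'v set \<Rightarrow> bool" where
  "generic_filter E V P le G \<longleftrightarrow>
     G \<subseteq> P \<and> G \<noteq> {} \<and>
     (\<forall>p\<in>G. \<forall>q\<in>P. le p q \<longrightarrow> q \<in> G) \<and>
     (\<forall>p\<in>G. \<forall>q\<in>G. \<exists>s\<in>G. le s p \<and> le s q) \<and>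
     (\<forall>d\<in>V. (\<forall>p\<in>P. \<exists>q\<in>P \<inter> elts E d. le q p) \<longrightarrow> G \<inter> elts E d \<noteq> {})"

text \<open>
  The universe \<open>UNIV :: 'v set\<close> is the generic extension \<open>V[G]\<close>: it consists of the values of
  the names in \<open>V\<close>, where \<open>val \<tau> = {val \<sigma> | \<exists>p\<in>G. (\<sigma>, p) \<in> \<tau>}\<close>. Every element of \<open>V\<close>
  is admitted as a name; elements of \<open>\<tau>\<close> that are not pairs \<open>(\<sigma>, p)\<close> with \<open>p\<close> a condition do not
  contribute to the value. Since \<open>E\<close> will be well-founded and extensional, the recursion
  equation determines \<open>val\<close> on \<open>V\<close>.
\<close>

definition generic_extension :: "('v \<Rightarrow> 'v \<Rightarrow> bool) \<Rightarrow> 'v set \<Rightarrow> 'v set \<Rightarrow> bool" where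
  "generic_extension E V G \<longleftrightarrow>
     (\<exists>val :: 'v \<Rightarrow> 'v.
        (\<forall>\<tau>\<in>V. elts E (val \<tau>) = {val \<sigma> |\<sigma>. \<exists>p\<in>G. \<exists>t\<in>elts E \<tau>. is_pair E \<sigma> p t}) \<and>
        val ` V = UNIV)"


section \<open>Cohen reals\<close>

text \<open>The finite sequence \<open>s\<close> stands for the function from \<open>n = length s\<close> to \<open>2\<close>.\<close>

definition cohen_conds :: "('v \<Rightarrow> 'v \<Rightarrow> bool) \<Rightarrow> 'v set \<Rightarrow> 'v set" where
  "cohen_conds E V =
     {u\<in>V. \<exists>s :: bool list.
        elts E u = graph_class E (\<lambda>i. if i < length s then Some (of_bool (s ! i)) else None)}"

definition cohen_le :: "('v \<Rightarrow> 'v \<Rightarrow> bool) \<Rightarrow> 'v \<Rightarrow> 'v \<Rightarrow> bool" where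
  "cohen_le E p q \<longleftrightarrow> elts E q \<subseteq> elts E p"

definition cohen_real ::
  "('v \<Rightarrow> 'v \<Rightarrow> bool) \<Rightarrow> 'v set \<Rightarrow> 'v set \<Rightarrow> (nat \<Rightarrow> bool) \<Rightarrow> bool" where
  "cohen_real E V G r \<longleftrightarrow>
     generic_filter E V (cohen_conds E V) (cohen_le E) G \<and>
     (\<Union>p\<in>G. elts E p) = graph_class E (\<lambda>i. Some (of_bool (r i)))"


section \<open>Random reals\<close>

definition coin_measure :: "(nat \<Rightarrow> bool) measure" where
  "coin_measure = (\<Pi>\<^sub>M n\<in>(UNIV :: nat set). uniform_count_measure (UNIV :: bool set))"

text \<open>
  Solovay's coding of the Borel subsets of \<open>2\<^sup>\<omega>\<close> by functions \<open>c : \<omega> \<rightarrow> \<omega>\<close>, starting from the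
  subbasic clopen sets \<open>{x. x n = 1}\<close> and closing under complements and countable unions.
\<close>

inductive borel_code :: "(nat \<Rightarrow> nat) \<Rightarrow> (nat \<Rightarrow> bool) set \<Rightarrow> bool" where
  subbasic: "c 0 = 0 \<Longrightarrow> borel_code c {x. x (c 1)}"
| complement: "c 0 = 1 \<Longrightarrow> borel_code (\<lambda>k. c (Suc k)) A \<Longrightarrow> borel_code c (- A)"
| union: "c 0 \<ge> 2 \<Longrightarrow> (\<And>n. borel_code (\<lambda>k. c (Suc (prod_encode (n, k)))) (A n)) \<Longrightarrow>
    borel_code c (\<Union>n. A n)"

definition codes_borel :: "('v \<Rightarrow> 'v \<Rightarrow> bool) \<Rightarrow> 'v \<Rightarrow> (nat \<Rightarrow> bool) set \<Rightarrow> bool" where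
  "codes_borel E u A \<longleftrightarrow> (\<exists>c. elts E u = graph_class E (\<lambda>i. Some (c i)) \<and> borel_code c A)"

text \<open>
  A nonzero class of Borel sets of \<open>V\<close> modulo null sets is represented by all the codes in \<open>V\<close> of
  its members. This replaces the partial order of classes by a preorder that has it as its quotient,
  which affects neither generic filters (being upward closed, they are unions of classes of codes)
  nor genericity. Nullness and inclusion modulo null sets of coded Borel sets are absolute
  between \<open>V\<close> and the ambient logic, so they are evaluated in the latter.
\<close>

definition random_conds :: "('v \<Rightarrow> 'v \<Rightarrow> bool) \<Rightarrow> 'v set \<Rightarrow> 'v set" where
  "random_conds E V = {u\<in>V. \<exists>A. codes_borel E u A \<and> A \<notin> null_sets coin_measure}"

definition random_le :: "('v \<Rightarrow> 'v \<Rightarrow> bool) \<Rightarrow> 'v \<Rightarrow> 'v \<Rightarrow> bool" where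
  "random_le E p q \<longleftrightarrow>
     (\<exists>A B. codes_borel E p A \<and> codes_borel E q B \<and> A - B \<in> null_sets coin_measure)"

definition random_real ::
  "('v \<Rightarrow> 'v \<Rightarrow> bool) \<Rightarrow> 'v set \<Rightarrow> 'v set \<Rightarrow> (nat \<Rightarrow> bool) \<Rightarrow> bool" where
  "random_real E V G r \<longleftrightarrow>
     generic_filter E V (random_conds E V) (random_le E) G \<and>
     \<Inter>{A. \<exists>p\<in>G. codes_borel E p A} = {r}"


section \<open>The real field of the universe, and definability\<close>

text \<open>
  A real number belongs to the universe iff its Dedekind cut does. The rational number
  \<open>(a - b) / (c + 1)\<close> is represented by the triples \<open>(a, (b, c))\<close> of natural numbers.
\<close>

definition reals_of :: "('v \<Rightarrow> 'v \<Rightarrow> bool) \<Rightarrow> real set" where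
  "reals_of E =
     {x. \<exists>u. elts E u =
        {t. \<exists>a b c a' b' c' p. (real a - real b) / (real c + 1) < x \<and>
              is_num E a a' \<and> is_num E b b' \<and> is_num E c c' \<and>
              is_pair E b' c' p \<and> is_pair E a' p t}}"

datatype ring_tm = TVar nat | TZero | TOne | TAdd ring_tm ring_tm | TMul ring_tm ring_tm

primrec tm_val :: "(nat \<Rightarrow> real) \<Rightarrow> ring_tm \<Rightarrow> real" where
  "tm_val e (TVar i) = e i"
| "tm_val e TZero = 0"
| "tm_val e TOne = 1"
| "tm_val e (TAdd s t) = tm_val e s + tm_val e t"
| "tm_val e (TMul s t) = tm_val e s * tm_val e t"

datatype ring_fm =
    FEq ring_tm ring_tm | FLess ring_tm ring_tm | FPred ring_tm
  | FNot ring_fm | FAnd ring_fm ring_fm | FEx nat ring_fm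

text \<open>Satisfaction in the structure \<open>(R, +, \<cdot>, <, 0, 1, U)\<close>, for \<open>R\<close> a subfield of the reals.\<close>

primrec fm_sat :: "real set \<Rightarrow> real set \<Rightarrow> (nat \<Rightarrow> real) \<Rightarrow> ring_fm \<Rightarrow> bool" where
  "fm_sat R U e (FEq s t) \<longleftrightarrow> tm_val e s = tm_val e t"
| "fm_sat R U e (FLess s t) \<longleftrightarrow> tm_val e s < tm_val e t"
| "fm_sat R U e (FPred t) \<longleftrightarrow> tm_val e t \<in> U"
| "fm_sat R U e (FNot \<phi>) \<longleftrightarrow> \<not> fm_sat R U e \<phi>"
| "fm_sat R U e (FAnd \<phi> \<psi>) \<longleftrightarrow> fm_sat R U e \<phi> \<and> fm_sat R U e \<psi>"
| "fm_sat R U e (FEx i \<phi>) \<longleftrightarrow> (\<exists>x\<in>R. fm_sat R U (e(i := x)) \<phi>)"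

text \<open>Definability with parameters; the parameters are the values of \<open>e\<close> at positive indices.\<close>

definition definable_in :: "real set \<Rightarrow> real set \<Rightarrow> real set \<Rightarrow> bool" where
  "definable_in R U X \<longleftrightarrow>
     (\<exists>\<phi> e. range e \<subseteq> R \<and> X = {x\<in>R. fm_sat R U (e(0 := x)) \<phi>})"

end

theory Submission
  imports Defs
begin

text \<open>
  The point is that every integer is a difference of two elements of \<open>r\<close>, so that \<open>\<int>\<close> is defined,
  without parameters, by \<open>\<exists>a b. a \<in> r \<and> b \<in> r \<and> x + a = b\<close>. As \<open>r \<subseteq> \<nat>\<close>, all such
  differences are integers; conversely it suffices that for every \<open>n\<close> there is an \<open>i\<close> with both
  \<open>i\<close> and \<open>i + n\<close> in \<open>r\<close>, and this is what genericity gives (\<open>cohen_shift\<close>, \<open>random_shift\<close>):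

  \<^item> a finite sequence can be prolonged so that it takes the value 1 at two places at distance \<open>n\<close>;
  \<^item> for \<open>n > 0\<close>, almost every \<open>x \<in> 2\<^sup>\<omega>\<close> satisfies \<open>x i = x (i + n) = 1\<close> for some \<open>i\<close>, because
    infinitely many disjoint pairs \<open>{i, i + n}\<close> offer independent chances of 1/4; so every Borel set
    of positive measure has a positive intersection with \<open>{x. x i = x (i + n) = 1}\<close> for some \<open>i\<close>.

  A generic filter meets only the dense sets that belong to \<open>V\<close>. The remaining work is to see that
  the two families of dense sets do belong to \<open>V\<close>, and that the stronger conditions needed for
  density do, too. For random forcing this involves a new Borel code, computed from an old one
  by means of the pairing function \<open>prod_encode\<close>, whose graph has therefore to be found in \<open>V\<close>.
  Also the integers themselves have to be reals of the universe: their Dedekind cuts are already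
  elements of \<open>V\<close> (\<open>Ints_subset_reals_of\<close>).

  To establish membership in \<open>V\<close>, separation is used through a calculus of definable predicates
  and definable operations (\<open>definable\<close>, \<open>definable_op\<close>): instead of writing formulas, one proves by
  applying introduction rules that a predicate stated in HOL is expressed by some formula with
  parameters. Recursively defined objects are obtained from \<open>V_set_reachable\<close>: if a well-founded
  relation is a set of \<open>V\<close>, so is the collection of points reachable from a given one.
\<close>

section \<open>Renaming the variables of formulas\<close>

primrec rename_fm :: "(nat \<Rightarrow> nat) \<Rightarrow> set_fm \<Rightarrow> set_fm" where
  "rename_fm f (SMem i j) = SMem (f i) (f j)"
| "rename_fm f (SEq i j) = SEq (f i) (f j)"
| "rename_fm f (SNot \<phi>) = SNot (rename_fm f \<phi>)"
| "rename_fm f (SAnd \<phi> \<psi>) = SAnd (rename_fm f \<phi>) (rename_fm f \<psi>)"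
| "rename_fm f (SEx i \<phi>) = SEx (f i) (rename_fm f \<phi>)"

lemma set_sat_rename_fm:
  assumes "inj f"
  shows "set_sat E M e (rename_fm f \<phi>) \<longleftrightarrow> set_sat E M (e \<circ> f) \<phi>"
proof (induction \<phi> arbitrary: e)
  case (SEx i \<phi>)
  have "e(f i := x) \<circ> f = (e \<circ> f)(i := x)" for x
    using assms by (auto simp: fun_eq_iff inj_def)
  then show ?case unfolding rename_fm.simps set_sat.simps SEx by simp
qed auto

text \<open>
  An assignment of which the even places hold the arguments of a predicate and the odd places its
  parameters. Thus parameters can be added, and those of two formulas merged, without
  interfering with the arguments.
\<close>
definition interleave :: "(nat \<Rightarrow> 'a) \<Rightarrow> (nat \<Rightarrow> 'a) \<Rightarrow> nat \<Rightarrow> 'a" where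
  "interleave e p = (\<lambda>i. if even i then e (i div 2) else p (i div 2))"

lemma range_interleave: "range e \<subseteq> A \<Longrightarrow> range p \<subseteq> A \<Longrightarrow> range (interleave e p) \<subseteq> A"
  by (auto simp: interleave_def)

section \<open>Sets of a transitive model\<close>

locale transitive_ZFC_class =
  fixes E :: "'v \<Rightarrow> 'v \<Rightarrow> bool" and V :: "'v set"
  assumes wf_E: "wfp E" and ext_E: "extensional_mem E"
    and trans_V: "transitive_class E V" and zfc: "ZFC_model E V"
begin

text \<open>
  HOL sets stand for the sets of \<open>V\<close>, so that HOL notation is available for them.
\<close>
definition V_set :: "'v set \<Rightarrow> bool" where
  "V_set X \<longleftrightarrow> (\<exists>u\<in>V. elts E u = X)"

lemma elts_inject: "elts E x = elts E y \<longleftrightarrow> x = y"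
  using ext_E by (auto simp: extensional_mem_def)

lemma mem_V: "E y x \<Longrightarrow> x \<in> V \<Longrightarrow> y \<in> V"
  using trans_V by (auto simp: transitive_class_def elts_def)

lemma elts_V: "x \<in> V \<Longrightarrow> elts E x \<subseteq> V"
  using trans_V by (auto simp: transitive_class_def)

lemma V_set_elts: "x \<in> V \<Longrightarrow> V_set (elts E x)"
  by (auto simp: V_set_def)

lemma V_set_subset: "V_set X \<Longrightarrow> X \<subseteq> V"
  using elts_V by (auto simp: V_set_def)

lemma mem_irrefl: "\<not> E x x"
  using wf_E by (metis wfp_eq_minimal singletonD singletonI)

text \<open>
  The axioms quantify over \<open>V\<close> only. By transitivity this determines all elements of a set of \<open>V\<close>.
\<close>
lemma elts_iff: "u \<in> V \<Longrightarrow> X \<subseteq> V \<Longrightarrow> elts E u = X \<longleftrightarrow> (\<forall>w\<in>V. E w u \<longleftrightarrow> w \<in> X)"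
  using mem_V by (auto simp: elts_def)

lemma V_set_iff: "X \<subseteq> V \<Longrightarrow> V_set X \<longleftrightarrow> (\<exists>u\<in>V. \<forall>w\<in>V. E w u \<longleftrightarrow> w \<in> X)"
  by (auto simp: V_set_def elts_iff)

text \<open>
  Pairing, union, power set, infinity and separation, in this order.
\<close>
lemmas zfc_axioms =
  zfc[unfolded ZFC_model_def, THEN conjunct2, THEN conjunct2, THEN conjunct1]
  zfc[unfolded ZFC_model_def, THEN conjunct2, THEN conjunct2, THEN conjunct2, THEN conjunct1]
  zfc[unfolded ZFC_model_def, THEN conjunct2, THEN conjunct2, THEN conjunct2,
    THEN conjunct2, THEN conjunct1]
  zfc[unfolded ZFC_model_def, THEN conjunct2, THEN conjunct2, THEN conjunct2,
    THEN conjunct2, THEN conjunct2, THEN conjunct1]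
  zfc[unfolded ZFC_model_def, THEN conjunct2, THEN conjunct2, THEN conjunct2,
    THEN conjunct2, THEN conjunct2, THEN conjunct2, THEN conjunct1]

lemma V_set_pair:
  assumes "a \<in> V" "b \<in> V"
  shows "V_set {a, b}"
proof -
  have "\<forall>x\<in>V. \<forall>y\<in>V. \<exists>z\<in>V. \<forall>w\<in>V. E w z \<longleftrightarrow> w = x \<or> w = y"
    by (rule zfc_axioms(1))
  then show ?thesis using assms by (simp add: V_set_iff)
qed

lemma V_set_Union:
  assumes "V_set X"
  shows "V_set (\<Union>x\<in>X. elts E x)"
proof -
  obtain x where x: "x \<in> V" "elts E x = X" using assms by (auto simp: V_set_def)
  have "\<forall>x\<in>V. \<exists>u\<in>V. \<forall>w\<in>V. E w u \<longleftrightarrow> (\<exists>y\<in>V. E y x \<and> E w y)"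
    by (rule zfc_axioms(2))
  then obtain u where u: "u \<in> V" "\<forall>w\<in>V. E w u \<longleftrightarrow> (\<exists>y\<in>V. E y x \<and> E w y)"
    using x(1) by blast
  have "elts E u = (\<Union>x\<in>X. elts E x)"
    using u x mem_V unfolding elts_def by blast
  with u(1) show ?thesis by (auto simp: V_set_def)
qed

lemma V_set_Pow:
  assumes "V_set X"
  shows "V_set {w\<in>V. elts E w \<subseteq> X}"
proof -
  obtain x where x: "x \<in> V" "elts E x = X" using assms by (auto simp: V_set_def)
  have "\<forall>x\<in>V. \<exists>p\<in>V. \<forall>w\<in>V. E w p \<longleftrightarrow> (\<forall>z\<in>V. E z w \<longrightarrow> E z x)"
    by (rule zfc_axioms(3))
  then obtain p where p: "p \<in> V" "\<forall>w\<in>V. E w p \<longleftrightarrow> (\<forall>z\<in>V. E z w \<longrightarrow> E z x)"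
    using x(1) by blast
  have "elts E p = {w\<in>V. elts E w \<subseteq> X}"
    using p x mem_V unfolding elts_def by blast
  with p(1) show ?thesis by (auto simp: V_set_def)
qed

lemma V_set_insert:
  assumes "x \<in> V" "V_set X"
  shows "V_set (insert x X)"
proof -
  obtain u where u: "u \<in> V" "elts E u = X" using assms by (auto simp: V_set_def)
  obtain s where s: "s \<in> V" "elts E s = {x}" using V_set_pair[OF assms(1) assms(1)] by (auto simp: V_set_def)
  have "V_set (\<Union>y\<in>{s, u}. elts E y)" by (intro V_set_Union V_set_pair s u)
  then show ?thesis using s u by simp
qed

lemma V_set_infinity:
  "\<exists>W. V_set W \<and> (\<exists>z\<in>W. elts E z = {}) \<and> (\<forall>y\<in>W. \<exists>s\<in>W. elts E s = insert y (elts E y))"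
proof -
  have "\<exists>x\<in>V. (\<exists>o0\<in>V. E o0 x \<and> (\<forall>z\<in>V. \<not> E z o0)) \<and>
        (\<forall>y\<in>V. E y x \<longrightarrow> (\<exists>s\<in>V. E s x \<and> (\<forall>z\<in>V. E z s \<longleftrightarrow> E z y \<or> z = y)))"
    by (rule zfc_axioms(4))
  then obtain x where x: "x \<in> V" "\<exists>o0\<in>V. E o0 x \<and> (\<forall>z\<in>V. \<not> E z o0)"
    "\<forall>y\<in>V. E y x \<longrightarrow> (\<exists>s\<in>V. E s x \<and> (\<forall>z\<in>V. E z s \<longleftrightarrow> E z y \<or> z = y))"
    by blast
  have 1: "\<exists>z\<in>elts E x. elts E z = {}"
    using x(2) mem_V unfolding elts_def by blast
  have 2: "\<exists>s\<in>elts E x. elts E s = insert y (elts E y)" if "y \<in> elts E x" for y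
  proof -
    have y: "y \<in> V" "E y x" using that elts_V[OF x(1)] by (auto simp: elts_def)
    then obtain s where "s \<in> V" "E s x" "\<forall>z\<in>V. E z s \<longleftrightarrow> E z y \<or> z = y" using x(3) by blast
    moreover have "insert y (elts E y) \<subseteq> V" using y elts_V by auto
    ultimately show ?thesis using y by (auto simp: elts_iff elts_def intro!: bexI[of _ s] mem_V)
  qed
  show ?thesis using V_set_elts[OF x(1)] 1 2 by blast
qed

lemma V_set_empty: "V_set {}"
  using V_set_infinity V_set_subset V_set_elts by fastforce

lemma V_set_finite: "finite X \<Longrightarrow> X \<subseteq> V \<Longrightarrow> V_set X"
  by (induction X rule: finite_induct) (auto simp: V_set_empty V_set_insert)

lemma V_set_separation_fm:
  assumes "V_set X" "range e \<subseteq> V"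
  shows "V_set {z\<in>X. set_sat E V (e(0 := z)) \<phi>}"
proof -
  obtain x where x: "x \<in> V" "elts E x = X" using assms by (auto simp: V_set_def)
  have "\<forall>\<phi> e. range e \<subseteq> V \<longrightarrow>
        (\<forall>x\<in>V. \<exists>y\<in>V. \<forall>z\<in>V. E z y \<longleftrightarrow> E z x \<and> set_sat E V (e(0 := z)) \<phi>)"
    by (rule zfc_axioms(5))
  then have "\<exists>y\<in>V. \<forall>z\<in>V. E z y \<longleftrightarrow> E z x \<and> set_sat E V (e(0 := z)) \<phi>"
    using x(1) assms(2) by blast
  then obtain y where y: "y \<in> V" "\<forall>z\<in>V. E z y \<longleftrightarrow> E z x \<and> set_sat E V (e(0 := z)) \<phi>"
    by blast
  have "elts E y = {z\<in>X. set_sat E V (e(0 := z)) \<phi>}"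
    using y x mem_V unfolding elts_def by blast
  with y(1) show ?thesis by (auto simp: V_set_def)
qed

section \<open>The calculus of definable predicates and operations\<close>

text \<open>
  A predicate takes its arguments as an assignment \<open>e\<close>; the values beyond the finitely many relevant
  ones are arbitrary elements of \<open>V\<close>. Arguments are de Bruijn indices: a quantifier binds \<open>e 0\<close>
  and shifts the other arguments (\<open>definable_ex\<close>), which makes the rules usable by
  higher-order unification.
\<close>
definition definable :: "((nat \<Rightarrow> 'v) \<Rightarrow> bool) \<Rightarrow> bool" where
  "definable P \<longleftrightarrow> (\<exists>\<phi> p. range p \<subseteq> V \<and>
     (\<forall>e. range e \<subseteq> V \<longrightarrow> (P e \<longleftrightarrow> set_sat E V (interleave e p) \<phi>)))"

lemma V_set_separation:
  assumes "V_set X" "definable (\<lambda>e. P (e 0))"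
  shows "V_set {z\<in>X. P z}"
proof -
  obtain \<phi> p where p: "range p \<subseteq> V"
    and \<phi>: "\<And>e. range e \<subseteq> V \<Longrightarrow> P (e 0) \<longleftrightarrow> set_sat E V (interleave e p) \<phi>"
    using assms(2) by (auto simp: definable_def)
  have "P z \<longleftrightarrow> set_sat E V ((interleave p p)(0 := z)) \<phi>" if "z \<in> V" for z
  proof -
    have "P z \<longleftrightarrow> set_sat E V (interleave (p(0 := z)) p) \<phi>"
      using \<phi>[of "p(0 := z)"] that p by (auto simp: image_subset_iff)
    also have "interleave (p(0 := z)) p = (interleave p p)(0 := z)"
      by (auto simp: interleave_def fun_eq_iff elim!: evenE)
    finally show ?thesis .
  qed
  then have "{z\<in>X. P z} = {z\<in>X. set_sat E V ((interleave p p)(0 := z)) \<phi>}"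
    using V_set_subset[OF assms(1)] by auto
  then show ?thesis
    using V_set_separation_fm[OF assms(1) range_interleave[OF p p]] by simp
qed

lemma definable_cong: "definable P \<Longrightarrow> (\<And>e. range e \<subseteq> V \<Longrightarrow> P e \<longleftrightarrow> Q e) \<Longrightarrow> definable Q"
  unfolding definable_def by metis

lemma definable_rename_fm:
  assumes "definable P" "inj g"
  shows "definable (\<lambda>e. P (\<lambda>i. e (g i)))"
proof -
  obtain \<phi> p where p: "range p \<subseteq> V"
    and \<phi>: "\<And>e. range e \<subseteq> V \<Longrightarrow> P e \<longleftrightarrow> set_sat E V (interleave e p) \<phi>"
    using assms(1) by (auto simp: definable_def)
  define h where "h i = (if even i then 2 * g (i div 2) else i)" for i
  have "inj h"
  proof (rule injI)
    fix x y assume *: "h x = h y"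
    then have ev: "even x \<longleftrightarrow> even y" unfolding h_def by (metis dvd_triv_left)
    show "x = y"
    proof (cases "even x")
      case True
      then have "x div 2 = y div 2" using * ev assms(2) by (simp add: inj_eq h_def)
      then show ?thesis using True ev by (metis even_two_times_div_two)
    qed (use * ev in \<open>simp add: h_def\<close>)
  qed
  moreover have "interleave (\<lambda>i. e (g i)) p = interleave e p \<circ> h" for e
    by (auto simp: interleave_def h_def fun_eq_iff)
  ultimately have "\<forall>e. range e \<subseteq> V \<longrightarrow> (P (\<lambda>i. e (g i)) \<longleftrightarrow> set_sat E V (interleave e p) (rename_fm h \<phi>))"
    using \<phi> by (auto simp: set_sat_rename_fm image_subset_iff)
  with p show ?thesis unfolding definable_def by blast
qed

lemma definable_not: "definable P \<Longrightarrow> definable (\<lambda>e. \<not> P e)"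
  unfolding definable_def by (metis set_sat.simps(3))

lemma definable_and:
  assumes "definable P" "definable Q"
  shows "definable (\<lambda>e. P e \<and> Q e)"
proof -
  obtain \<phi> p where p: "range p \<subseteq> V"
    and \<phi>: "\<And>e. range e \<subseteq> V \<Longrightarrow> P e \<longleftrightarrow> set_sat E V (interleave e p) \<phi>"
    using assms(1) by (auto simp: definable_def)
  obtain \<psi> q where q: "range q \<subseteq> V"
    and \<psi>: "\<And>e. range e \<subseteq> V \<Longrightarrow> Q e \<longleftrightarrow> set_sat E V (interleave e q) \<psi>"
    using assms(2) by (auto simp: definable_def)
  \<comment> \<open>the two parameter sequences are interleaved in turn\<close>
  define f :: "nat \<Rightarrow> nat" where "f i = (if even i then i else 4 * (i div 2) + 1)" for i
  define g :: "nat \<Rightarrow> nat" where "g i = (if even i then i else 4 * (i div 2) + 3)" for i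
  have f: "inj f" and g: "inj g"
    by (rule inj_on_inverseI[of _ "\<lambda>j. if even j then j else 2 * (j div 4) + 1"];
        auto simp: f_def g_def elim!: oddE)+
  have [simp]: "(4 * k + 3) div 2 = Suc (2 * k)" for k :: nat
    by presburger
  have "interleave e (interleave p q) \<circ> f = interleave e p" for e
    by (auto simp: interleave_def f_def fun_eq_iff elim!: oddE)
  moreover have "interleave e (interleave p q) \<circ> g = interleave e q" for e
    by (auto simp: interleave_def g_def fun_eq_iff elim!: oddE)
  ultimately have "\<forall>e. range e \<subseteq> V \<longrightarrow> (P e \<and> Q e \<longleftrightarrow>
      set_sat E V (interleave e (interleave p q)) (SAnd (rename_fm f \<phi>) (rename_fm g \<psi>)))"
    using \<phi> \<psi> f g by (auto simp: set_sat_rename_fm)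
  then show ?thesis using range_interleave[OF p q] unfolding definable_def by blast
qed

lemma definable_or: "definable P \<Longrightarrow> definable Q \<Longrightarrow> definable (\<lambda>e. P e \<or> Q e)"
  by (rule definable_cong[OF definable_not[OF definable_and[OF definable_not definable_not]]]) auto

lemma definable_imp: "definable P \<Longrightarrow> definable Q \<Longrightarrow> definable (\<lambda>e. P e \<longrightarrow> Q e)"
  by (rule definable_cong[OF definable_or[OF definable_not]]) auto

lemma definable_iff: "definable P \<Longrightarrow> definable Q \<Longrightarrow> definable (\<lambda>e. P e \<longleftrightarrow> Q e)"
  by (rule definable_cong[of "\<lambda>e. (P e \<longrightarrow> Q e) \<and> (Q e \<longrightarrow> P e)"]) (auto intro: definable_and definable_imp)

text \<open>
  The bound variable must not be an argument of the quantified formula, so it is kept at a new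
  parameter place, namely the first; the other parameters move up by one.
\<close>
lemma definable_ex:
  assumes "definable (\<lambda>e. Q (\<lambda>i. e (Suc i)) (e 0))"
  shows "definable (\<lambda>e. \<exists>x\<in>V. Q e x)"
proof -
  obtain \<phi> p where p: "range p \<subseteq> V"
    and \<phi>: "\<And>e. range e \<subseteq> V \<Longrightarrow> Q (\<lambda>i. e (Suc i)) (e 0) \<longleftrightarrow> set_sat E V (interleave e p) \<phi>"
    using assms by (auto simp: definable_def)
  define f :: "nat \<Rightarrow> nat" where "f i = (if i = 0 then 1 else if even i then i - 2 else i + 2)" for i
  define q where "q = case_nat (p 0) p"
  have f: "inj f"
    unfolding f_def inj_def by (auto; presburger)
  have q: "range q \<subseteq> V" using p by (auto simp: q_def split: nat.split)
  have eq: "(interleave e q)(1 := x) \<circ> f = interleave (case_nat x e) p" for e x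
  proof
    fix i :: nat
    consider "i = 0" | k where "i = 2 * k + 2" | k where "i = 2 * k + 1"
      by (metis add_2_eq_Suc' evenE mult_Suc_right not0_implies_Suc oddE add.commute mult_is_0)
    then show "((interleave e q)(1 := x) \<circ> f) i = interleave (case_nat x e) p i"
      by cases (auto simp: interleave_def f_def q_def)
  qed
  have "(\<exists>x\<in>V. Q e x) \<longleftrightarrow> set_sat E V (interleave e q) (SEx 1 (rename_fm f \<phi>))" if "range e \<subseteq> V" for e
  proof -
    have "Q e x \<longleftrightarrow> set_sat E V ((interleave e q)(1 := x)) (rename_fm f \<phi>)" if "x \<in> V" for x
    proof -
      have "range (case_nat x e) \<subseteq> V"
        using \<open>range e \<subseteq> V\<close> that by (auto simp: image_subset_iff split: nat.split)
      from \<phi>[OF this] show ?thesis using eq[of e x] by (simp add: set_sat_rename_fm f)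
    qed
    then show ?thesis by simp
  qed
  with q show ?thesis unfolding definable_def by blast
qed

lemma definable_all:
  assumes "definable (\<lambda>e. Q (\<lambda>i. e (Suc i)) (e 0))"
  shows "definable (\<lambda>e. \<forall>x\<in>V. Q e x)"
  by (rule definable_cong[OF definable_not[OF definable_ex[of "\<lambda>e x. \<not> Q e x"]]]) (auto intro: definable_not assms)

text \<open>
  Operations with a definable graph serve as terms. With them, atomic formulas such as
  \<open>opair x (succ y) \<in> u\<close> need no quantifiers for their intermediate values.
\<close>
definition definable_op :: "((nat \<Rightarrow> 'v) \<Rightarrow> 'v) \<Rightarrow> bool" where
  "definable_op t \<longleftrightarrow> (\<forall>e. range e \<subseteq> V \<longrightarrow> t e \<in> V) \<and> definable (\<lambda>e. e 0 = t (\<lambda>i. e (Suc i)))"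

lemma V_nonempty: "\<exists>c. c \<in> V"
  using V_set_empty by (auto simp: V_set_def)

lemma definable_atoms: "definable (\<lambda>e. E (e i) (e j))" "definable (\<lambda>e. e i = e j)"
proof -
  obtain c where c: "c \<in> V" using V_nonempty by blast
  show "definable (\<lambda>e. E (e i) (e j))"
    unfolding definable_def using c
    by (intro exI[of _ "SMem (2 * i) (2 * j)"] exI[of _ "\<lambda>_. c"]) (auto simp: interleave_def)
  show "definable (\<lambda>e. e i = e j)"
    unfolding definable_def using c
    by (intro exI[of _ "SEq (2 * i) (2 * j)"] exI[of _ "\<lambda>_. c"]) (auto simp: interleave_def)
qed

lemma definable_op_var: "definable_op (\<lambda>e. e i)"
  unfolding definable_op_def by (auto intro: definable_atoms)

lemma definable_op_const: "c \<in> V \<Longrightarrow> definable_op (\<lambda>_. c)"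
  unfolding definable_op_def definable_def
  by (auto simp: interleave_def intro!: exI[of _ "SEq 0 1"] exI[of _ "\<lambda>_. c"])

lemma definable_op_V: "definable_op t \<Longrightarrow> range e \<subseteq> V \<Longrightarrow> t e \<in> V"
  by (auto simp: definable_op_def)

lemma definable_op_shift: "definable_op t \<Longrightarrow> definable_op (\<lambda>e. t (\<lambda>i. e (Suc i)))"
proof -
  assume t: "definable_op t"
  have inj: "inj (case_nat 0 (\<lambda>i. Suc (Suc i)))"
    by (auto simp: inj_def split: nat.splits)
  have "definable (\<lambda>e. e 0 = t (\<lambda>i. e (Suc (Suc i))))"
    using definable_rename_fm[OF _ inj, of "\<lambda>e. e 0 = t (\<lambda>i. e (Suc i))"] t by (simp add: definable_op_def)
  then show ?thesis
    using definable_op_V[OF t] unfolding definable_op_def by (auto simp: image_subset_iff)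
qed

lemma definable_subst:
  assumes "definable (\<lambda>e. P (\<lambda>i. e (Suc i)) (e 0))" "definable_op t"
  shows "definable (\<lambda>e. P e (t e))"
proof (rule definable_cong)
  show "definable (\<lambda>e. \<exists>x\<in>V. x = t e \<and> P e x)"
    using assms(2) unfolding definable_op_def by (intro definable_ex definable_and assms(1)) auto
qed (use definable_op_V[OF assms(2)] in auto)

text \<open>
  Substitution of terms for three variables of a predicate. The variables are replaced one at a time,
  the last one first; permutations bring the next one to the place \<open>0\<close>, where \<open>definable_subst\<close> acts.
\<close>
lemma definable_app:
  assumes P: "definable (\<lambda>e. P (e 0) (e (Suc 0)) (e (Suc (Suc 0))))"
    and t: "definable_op t" and s: "definable_op s" and r: "definable_op r"
  shows "definable (\<lambda>e. P (t e) (s e) (r e))"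
proof -
  define g :: "nat \<Rightarrow> nat" where "g = (\<lambda>i. i)(0 := Suc 0, Suc 0 := Suc (Suc 0), Suc (Suc 0) := 0)"
  define h :: "nat \<Rightarrow> nat" where "h = (\<lambda>i. i)(0 := Suc 0, Suc 0 := 0)"
  have g: "inj g" and h: "inj h"
    by (auto simp: inj_def g_def h_def)
  have "definable (\<lambda>e. P (e (Suc 0)) (e (Suc (Suc 0))) (e 0))"
    using definable_rename_fm[OF P g] by (simp add: g_def)
  from definable_subst[of "\<lambda>e z. P (e 0) (e (Suc 0)) z", OF this definable_op_shift[OF definable_op_shift[OF r]]]
  have 1: "definable (\<lambda>e. P (e 0) (e (Suc 0)) (r (\<lambda>i. e (Suc (Suc i)))))" .
  have "definable (\<lambda>e. P (e (Suc 0)) (e 0) (r (\<lambda>i. e (Suc (Suc i)))))"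
    using definable_rename_fm[OF 1 h] by (simp add: h_def)
  from definable_subst[of "\<lambda>e y. P (e 0) y (r (\<lambda>i. e (Suc i)))", OF this definable_op_shift[OF s]]
  have "definable (\<lambda>e. P (e 0) (s (\<lambda>i. e (Suc i))) (r (\<lambda>i. e (Suc i))))" .
  from definable_subst[of "\<lambda>e x. P x (s e) (r e)", OF this t]
  show ?thesis .
qed

lemma definable_mem: "definable_op t \<Longrightarrow> definable_op s \<Longrightarrow> definable (\<lambda>e. E (t e) (s e))"
  by (rule definable_app[of "\<lambda>x y z. E x y" t s s]) (auto intro: definable_atoms)

lemma definable_eq: "definable_op t \<Longrightarrow> definable_op s \<Longrightarrow> definable (\<lambda>e. t e = s e)"
  by (rule definable_app[of "\<lambda>x y z. x = y" t s s]) (auto intro: definable_atoms)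

lemma definable_op_app:
  assumes f: "\<And>x y. x \<in> V \<Longrightarrow> y \<in> V \<Longrightarrow> f x y \<in> V"
    and "definable (\<lambda>e. e 0 = f (e (Suc 0)) (e (Suc (Suc 0))))" and t: "definable_op t" and s: "definable_op s"
  shows "definable_op (\<lambda>e. f (t e) (s e))"
  unfolding definable_op_def
  using definable_app[of "\<lambda>x y z. x = f y z", OF assms(2) definable_op_var definable_op_shift[OF t] definable_op_shift[OF s]]
  by (auto intro: f definable_op_V[OF t] definable_op_V[OF s])

lemma definable_set: "V_set X \<Longrightarrow> definable_op t \<Longrightarrow> definable (\<lambda>e. t e \<in> X)"
  unfolding V_set_def elts_def using definable_mem[OF _ definable_op_const, of t] by auto

lemma definable_bex:
  assumes "V_set X" "definable (\<lambda>e. Q (\<lambda>i. e (Suc i)) (e 0))"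
  shows "definable (\<lambda>e. \<exists>x\<in>X. Q e x)"
proof (rule definable_cong)
  show "definable (\<lambda>e. \<exists>x\<in>V. x \<in> X \<and> Q e x)"
    by (intro definable_ex definable_and definable_set assms definable_op_var)
qed (use V_set_subset[OF assms(1)] in auto)

lemma definable_ball:
  assumes "V_set X" "definable (\<lambda>e. Q (\<lambda>i. e (Suc i)) (e 0))"
  shows "definable (\<lambda>e. \<forall>x\<in>X. Q e x)"
proof (rule definable_cong)
  show "definable (\<lambda>e. \<forall>x\<in>V. x \<in> X \<longrightarrow> Q e x)"
    by (intro definable_all definable_imp definable_set assms definable_op_var)
qed (use V_set_subset[OF assms(1)] in auto)

lemmas definable_base = definable_and definable_or definable_not definable_imp definable_iff definable_mem definable_eq definable_op_var definable_op_const

section \<open>Ordered pairs, products and recursion\<close>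

lemma V_set_Un:
  assumes "V_set X" "V_set Y"
  shows "V_set (X \<union> Y)"
proof -
  obtain u v where uv: "u \<in> V" "elts E u = X" "v \<in> V" "elts E v = Y"
    using assms by (auto simp: V_set_def)
  have "V_set (\<Union>x\<in>{u, v}. elts E x)" by (intro V_set_Union V_set_pair uv)
  then show ?thesis using uv by simp
qed

text \<open>
  Uniqueness holds by extensionality of the universe, existence for arguments in \<open>V\<close>.
\<close>
definition opair :: "'v \<Rightarrow> 'v \<Rightarrow> 'v" where
  "opair a b = (THE p. is_pair E a b p)"

definition succ :: "'v \<Rightarrow> 'v" where
  "succ x = (THE y. elts E y = insert x (elts E x))"

lemma is_pair_unique: "is_pair E a b p \<Longrightarrow> is_pair E a b q \<Longrightarrow> p = q"
  unfolding is_pair_def by (metis elts_inject)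

lemma is_pair_ex: "a \<in> V \<Longrightarrow> b \<in> V \<Longrightarrow> \<exists>p\<in>V. is_pair E a b p"
proof -
  assume a: "a \<in> V" and b: "b \<in> V"
  obtain u v where uv: "u \<in> V" "elts E u = {a}" "v \<in> V" "elts E v = {a, b}"
    using V_set_pair[OF a a] V_set_pair[OF a b] by (auto simp: V_set_def)
  then obtain p where "p \<in> V" "elts E p = {u, v}"
    using V_set_pair[of u v] by (auto simp: V_set_def)
  with uv show ?thesis unfolding is_pair_def by blast
qed

lemma is_pair_iff: "a \<in> V \<Longrightarrow> b \<in> V \<Longrightarrow> is_pair E a b p \<longleftrightarrow> p = opair a b"
proof -
  assume "a \<in> V" "b \<in> V"
  then obtain q where q: "is_pair E a b q" using is_pair_ex by blast
  then have "opair a b = q" unfolding opair_def using is_pair_unique by blast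
  then show ?thesis using q is_pair_unique by blast
qed

lemma opair_V [simp, intro]: "a \<in> V \<Longrightarrow> b \<in> V \<Longrightarrow> opair a b \<in> V"
  using is_pair_ex is_pair_iff by metis

lemma opair_inject [simp]:
  assumes "a \<in> V" "b \<in> V" "c \<in> V" "d \<in> V"
  shows "opair a b = opair c d \<longleftrightarrow> a = c \<and> b = d"
proof
  assume *: "opair a b = opair c d"
  obtain u v where 1: "elts E u = {a}" "elts E v = {a, b}" "elts E (opair a b) = {u, v}"
    using assms is_pair_iff[of a b "opair a b"] by (auto simp: is_pair_def)
  obtain u' v' where 2: "elts E u' = {c}" "elts E v' = {c, d}" "elts E (opair c d) = {u', v'}"
    using assms is_pair_iff[of c d "opair c d"] by (auto simp: is_pair_def)
  have "{u, v} = {u', v'}" using * 1 2 by simp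
  then have "{elts E u, elts E v} = {elts E u', elts E v'}"
    by (metis image_empty image_insert)
  then show "a = c \<and> b = d"
    unfolding 1 2 by (metis doubleton_eq_iff insert_absorb2)
qed auto

lemma definable_op_opair:
  assumes "definable_op t" "definable_op s"
  shows "definable_op (\<lambda>e. opair (t e) (s e))"
proof (rule definable_op_app[of opair, OF _ _ assms])
  show "definable (\<lambda>e. e 0 = opair (e (Suc 0)) (e (Suc (Suc 0))))"
  proof (rule definable_cong)
    \<comment> \<open>Kuratowski pairs spelled out with membership and equality only\<close>
    show "definable (\<lambda>e. \<exists>u\<in>V. \<exists>v\<in>V. (\<forall>w\<in>V. E w u \<longleftrightarrow> w = e (Suc 0)) \<and>
        (\<forall>w\<in>V. E w v \<longleftrightarrow> w = e (Suc 0) \<or> w = e (Suc (Suc 0))) \<and>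
        (\<forall>w\<in>V. E w (e 0) \<longleftrightarrow> w = u \<or> w = v))"
      by (intro definable_ex definable_all definable_base)
    fix e :: "nat \<Rightarrow> 'v" assume "range e \<subseteq> V"
    then have e: "e i \<in> V" for i by auto
    have "e 0 = opair (e (Suc 0)) (e (Suc (Suc 0))) \<longleftrightarrow> is_pair E (e (Suc 0)) (e (Suc (Suc 0))) (e 0)"
      using e by (simp add: is_pair_iff)
    also have "\<dots> \<longleftrightarrow> (\<exists>u\<in>V. \<exists>v\<in>V. elts E u = {e (Suc 0)} \<and>
        elts E v = {e (Suc 0), e (Suc (Suc 0))} \<and> elts E (e 0) = {u, v})"
      unfolding is_pair_def using elts_V[OF e[of 0]] by blast
    also have "\<dots> \<longleftrightarrow> (\<exists>u\<in>V. \<exists>v\<in>V. (\<forall>w\<in>V. E w u \<longleftrightarrow> w = e (Suc 0)) \<and>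
        (\<forall>w\<in>V. E w v \<longleftrightarrow> w = e (Suc 0) \<or> w = e (Suc (Suc 0))) \<and>
        (\<forall>w\<in>V. E w (e 0) \<longleftrightarrow> w = u \<or> w = v))"
      using e by (intro bex_cong refl) (simp add: elts_iff)
    finally show "(\<exists>u\<in>V. \<exists>v\<in>V. (\<forall>w\<in>V. E w u \<longleftrightarrow> w = e (Suc 0)) \<and>
        (\<forall>w\<in>V. E w v \<longleftrightarrow> w = e (Suc 0) \<or> w = e (Suc (Suc 0))) \<and>
        (\<forall>w\<in>V. E w (e 0) \<longleftrightarrow> w = u \<or> w = v)) \<longleftrightarrow> e 0 = opair (e (Suc 0)) (e (Suc (Suc 0)))" ..
  qed
qed auto

lemma elts_succ: "x \<in> V \<Longrightarrow> elts E (succ x) = insert x (elts E x)"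
  and succ_V [simp, intro]: "x \<in> V \<Longrightarrow> succ x \<in> V"
proof -
  assume x: "x \<in> V"
  then obtain y where y: "y \<in> V" "elts E y = insert x (elts E x)"
    using V_set_insert[OF x V_set_elts[OF x]] by (auto simp: V_set_def)
  then have "succ x = y"
    unfolding succ_def by (metis (mono_tags, lifting) elts_inject the_equality)
  with y show "elts E (succ x) = insert x (elts E x)" "succ x \<in> V" by auto
qed

lemma mem_succ: "x \<in> V \<Longrightarrow> E x (succ x)"
  using elts_succ unfolding elts_def by blast

lemma definable_op_succ: "definable_op t \<Longrightarrow> definable_op (\<lambda>e. succ (t e))"
proof (rule definable_op_app[of "\<lambda>x y. succ x" t t])
  show "definable (\<lambda>e. e 0 = succ (e (Suc 0)))"
  proof (rule definable_cong)
    show "definable (\<lambda>e. \<forall>w\<in>V. E w (e 0) \<longleftrightarrow> E w (e (Suc 0)) \<or> w = e (Suc 0))"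
      by (intro definable_ex definable_all definable_base)
    fix e :: "nat \<Rightarrow> 'v" assume "range e \<subseteq> V"
    then have e: "e i \<in> V" for i by auto
    have "e 0 = succ (e (Suc 0)) \<longleftrightarrow> elts E (e 0) = insert (e (Suc 0)) (elts E (e (Suc 0)))"
      using e by (metis elts_succ elts_inject)
    also have "\<dots> \<longleftrightarrow> (\<forall>w\<in>V. E w (e 0) \<longleftrightarrow> E w (e (Suc 0)) \<or> w = e (Suc 0))"
      using e elts_V[OF e] by (subst elts_iff) (auto simp: elts_def)
    finally show "(\<forall>w\<in>V. E w (e 0) \<longleftrightarrow> E w (e (Suc 0)) \<or> w = e (Suc 0)) \<longleftrightarrow> e 0 = succ (e (Suc 0))" ..
  qed
qed auto

lemma succ_pow_V [simp, intro]: "x \<in> V \<Longrightarrow> (succ ^^ n) x \<in> V"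
  by (induction n) auto

lemma definable_op_succ_pow: "definable_op t \<Longrightarrow> definable_op (\<lambda>e. (succ ^^ n) (t e))"
  by (induction n) (auto intro: definable_op_succ)

lemmas definable_intros = definable_bex definable_ball definable_and definable_or
  definable_not definable_imp definable_iff definable_set definable_mem definable_eq
  definable_op_opair definable_op_succ_pow definable_op_succ definable_op_var definable_op_const

lemma V_set_times:
  assumes "V_set X" "V_set Y"
  shows "V_set {opair x y |x y. x \<in> X \<and> y \<in> Y}"
proof -
  let ?P = "{p\<in>V. elts E p \<subseteq> {w\<in>V. elts E w \<subseteq> X \<union> Y}}"
  have XY: "X \<subseteq> V" "Y \<subseteq> V" using assms V_set_subset by auto
  have "V_set {z\<in>?P. \<exists>x\<in>X. \<exists>y\<in>Y. z = opair x y}"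
    by (rule V_set_separation) (intro V_set_Pow V_set_Un assms definable_intros)+
  also have "{z\<in>?P. \<exists>x\<in>X. \<exists>y\<in>Y. z = opair x y} = {opair x y |x y. x \<in> X \<and> y \<in> Y}"
  proof -
    \<comment> \<open>a Kuratowski pair belongs to the second iterated power set\<close>
    have "opair x y \<in> ?P" if "x \<in> X" "y \<in> Y" for x y
    proof -
      have xy: "x \<in> V" "y \<in> V" using that XY by auto
      obtain u v where "elts E u = {x}" "elts E v = {x, y}" "elts E (opair x y) = {u, v}"
        using xy is_pair_iff[of x y "opair x y"] by (auto simp: is_pair_def)
      then show ?thesis using that xy elts_V[of "opair x y"] by auto
    qed
    then show ?thesis by blast
  qed
  finally show ?thesis .
qed

text \<open>
  This replaces definitions by recursion inside \<open>V\<close>. The intersection \<open>T\<close> of all closed sets of \<open>V\<close>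
  that contain \<open>x0\<close> is definable, and contains all reachable points. If it had others, let \<open>t\<close> be
  one that is minimal for \<open>R\<close>. The predecessors of \<open>t\<close> in \<open>T\<close> would be reachable, hence
  there are none, and \<open>T\<close> without \<open>t\<close> would be a smaller closed set of \<open>V\<close>. Well-foundedness is that of
  the ambient logic, so that no induction has to be carried out inside \<open>V\<close>.
\<close>
lemma V_set_reachable:
  assumes X: "V_set X" and R: "V_set {opair x y |x y. (x, y) \<in> R}" and RX: "R \<subseteq> X \<times> X"
    and wfR: "wf R" and x0: "x0 \<in> X"
  shows "V_set {x. (x0, x) \<in> R\<^sup>*}"
proof -
  have XV: "X \<subseteq> V" using X V_set_subset by auto
  define RR where "RR = {opair x y |x y. (x, y) \<in> R}"
  have mem_R: "opair x y \<in> RR \<longleftrightarrow> (x, y) \<in> R" if "x \<in> X" "y \<in> X" for x y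
  proof
    assume "opair x y \<in> RR"
    then obtain a b where "opair x y = opair a b" "(a, b) \<in> R" unfolding RR_def by blast
    moreover from this have "a \<in> V" "b \<in> V" "x \<in> V" "y \<in> V" using RX XV that by auto
    ultimately show "(x, y) \<in> R" by simp
  qed (auto simp: RR_def)
  define closed where "closed S \<longleftrightarrow> x0 \<in> S \<and> (\<forall>x y. x \<in> S \<and> (x, y) \<in> R \<longrightarrow> y \<in> S)" for S
  define T where "T = {t\<in>X. \<forall>S. V_set S \<and> S \<subseteq> X \<and> closed S \<longrightarrow> t \<in> S}"
  have T: "V_set T"
  proof -
    have "V_set {t\<in>X. \<forall>S\<in>V. (\<forall>x\<in>V. E x S \<longrightarrow> x \<in> X) \<and> E x0 S \<and>
        (\<forall>x\<in>X. \<forall>y\<in>X. E x S \<and> opair x y \<in> RR \<longrightarrow> E y S) \<longrightarrow> E t S}"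
      using x0 XV by (intro V_set_separation X definable_all definable_intros R[folded RR_def]) auto
    also have "\<dots> = T"
    proof -
      have "closed (elts E S) \<longleftrightarrow> E x0 S \<and> (\<forall>x\<in>X. \<forall>y\<in>X. E x S \<and> opair x y \<in> RR \<longrightarrow> E y S)" for S
      proof -
        have "(\<forall>x y. E x S \<and> (x, y) \<in> R \<longrightarrow> E y S) \<longleftrightarrow>
            (\<forall>x\<in>X. \<forall>y\<in>X. E x S \<and> opair x y \<in> RR \<longrightarrow> E y S)"
          using mem_R RX by blast
        then show ?thesis by (simp add: closed_def elts_def)
      qed
      moreover have "elts E S \<subseteq> X \<longleftrightarrow> (\<forall>x\<in>V. E x S \<longrightarrow> x \<in> X)" if "S \<in> V" for S
        using that mem_V by (auto simp: elts_def)
      moreover have "T = {t\<in>X. \<forall>S\<in>V. elts E S \<subseteq> X \<and> closed (elts E S) \<longrightarrow> t \<in> elts E S}"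
        unfolding T_def V_set_def by blast
      ultimately show ?thesis by (simp add: elts_def[of E] cong: ball_cong)
    qed
    finally show ?thesis .
  qed
  have TX: "T \<subseteq> X" by (auto simp: T_def)
  have reach_T: "x \<in> T" if "(x0, x) \<in> R\<^sup>*" for x
    using that
  proof induction
    case base
    then show ?case using x0 by (auto simp: T_def closed_def)
  next
    case (step y z)
    then show ?case using RX unfolding T_def closed_def by blast
  qed
  have T_reach: "(x0, x) \<in> R\<^sup>*" if "x \<in> T" for x
  proof (rule ccontr)
    assume "(x0, x) \<notin> R\<^sup>*"
    with that have "x \<in> {x\<in>T. (x0, x) \<notin> R\<^sup>*}" by simp
    then obtain t where t: "t \<in> T" "(x0, t) \<notin> R\<^sup>*"
      and min: "\<And>y. (y, t) \<in> R \<Longrightarrow> y \<in> T \<Longrightarrow> (x0, y) \<in> R\<^sup>*"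
      using wfR unfolding wf_eq_minimal by (smt (verit) mem_Collect_eq)
    have "V_set {x\<in>T. x \<noteq> t}"
      using t TX XV by (intro V_set_separation T definable_intros) auto
    moreover have "closed {x\<in>T. x \<noteq> t}"
    proof -
      have "x0 \<in> T" by (rule reach_T) simp
      moreover have "x0 \<noteq> t" using t(2) by auto
      moreover have "y \<in> T" if "x \<in> T" "(x, y) \<in> R" for x y
        using that RX unfolding T_def closed_def by blast
      moreover have "y \<noteq> t" if "x \<in> T" "(x, y) \<in> R" for x y
        using min[of x] that t(2) by (metis rtrancl.rtrancl_into_rtrancl)
      ultimately show ?thesis unfolding closed_def by blast
    qed
    ultimately have "t \<in> {x\<in>T. x \<noteq> t}"
      using t(1) TX by (auto simp: T_def)
    then show False by simp
  qed
  show ?thesis using T reach_T T_reach by (metis (no_types, lifting) Collect_cong Collect_mem_eq)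
qed

section \<open>The natural numbers in the model\<close>

definition num :: "nat \<Rightarrow> 'v" where
  "num n = (succ ^^ n) (THE z. elts E z = {})"

definition Nums :: "'v set" where "Nums = range num"

lemma elts_num_0: "elts E (num 0) = {}" and num_0_V: "num 0 \<in> V"
proof -
  obtain z where z: "z \<in> V" "elts E z = {}" using V_set_empty by (auto simp: V_set_def)
  then have "(THE z. elts E z = {}) = z" using elts_inject by (intro the_equality) metis+
  then have "num 0 = z" by (simp add: num_def)
  with z show "elts E (num 0) = {}" "num 0 \<in> V" by auto
qed

lemma num_Suc: "num (Suc n) = succ (num n)"
  by (simp add: num_def)

lemma succ_pow_num: "(succ ^^ k) (num n) = num (n + k)"
  by (induction k) (auto simp: num_Suc)

lemma num_V [simp, intro]: "num n \<in> V"
  using num_0_V succ_pow_num[of n 0] by (metis add_0 succ_pow_V)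

lemma is_num_iff: "is_num E n x \<longleftrightarrow> x = num n"
proof (induction n arbitrary: x)
  case 0
  then show ?case using elts_num_0 elts_inject by (metis is_num.simps(1))
next
  case (Suc n)
  then show ?case using elts_succ[OF num_V[of n]] elts_inject by (simp add: num_Suc) metis
qed

lemma elts_num: "elts E (num n) = num ` {..<n}"
  by (induction n) (auto simp: elts_num_0 num_Suc elts_succ lessThan_Suc)

lemma num_mem_less: "m < n \<Longrightarrow> E (num m) (num n)"
  using elts_num[of n] unfolding elts_def by blast

lemma num_inject [simp]: "num m = num n \<longleftrightarrow> m = n"
  by (metis mem_irrefl num_mem_less linorder_neqE_nat)

lemma num_mem_iff: "E (num m) (num n) \<longleftrightarrow> m < n"
  using elts_num[of n] unfolding elts_def by (auto simp: set_eq_iff image_iff) 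

text \<open>
  The infinity axiom only gives an inductive set \<open>W\<close>. The numbers are what is reachable in it from
  \<open>0\<close> by the successor operation, which is well-founded because membership is.
\<close>
lemma V_set_Nums [intro]: "V_set Nums"
proof -
  obtain W where W: "V_set W" "\<exists>z\<in>W. elts E z = {}" "\<forall>y\<in>W. \<exists>s\<in>W. elts E s = insert y (elts E y)"
    using V_set_infinity by blast
  have WV: "W \<subseteq> V" using W(1) V_set_subset by auto
  have W0: "num 0 \<in> W" using W(2) elts_num_0 elts_inject by metis
  have Wsc: "succ x \<in> W" if "x \<in> W" for x
    using W(3) that WV elts_succ elts_inject by (metis subsetD)
  define R where "R = {(x, succ x) |x. x \<in> W}"
  have R: "V_set {opair x y |x y. (x, y) \<in> R}"
  proof -
    have "V_set {z\<in>{opair x y |x y. x \<in> W \<and> y \<in> W}. \<exists>x\<in>W. z = opair x (succ x)}"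
      by (rule V_set_separation) (intro V_set_times W(1) definable_intros)+
    also have "\<dots> = {opair x y |x y. (x, y) \<in> R}"
      unfolding R_def using Wsc by blast
    finally show ?thesis .
  qed
  have "R \<subseteq> {(x, y). E x y}" using WV mem_succ by (auto simp: R_def)
  moreover have "wf {(x, y). E x y}" using wf_E by (simp add: wfp_def)
  ultimately have "wf R" using wf_subset by blast
  moreover have "R \<subseteq> W \<times> W" using Wsc by (auto simp: R_def)
  ultimately have "V_set {x. (num 0, x) \<in> R\<^sup>*}"
    using W(1) R W0 by (intro V_set_reachable)
  also have "{x. (num 0, x) \<in> R\<^sup>*} = Nums"
  proof (intro set_eqI iffI; unfold mem_Collect_eq Nums_def)
    fix x assume "(num 0, x) \<in> R\<^sup>*"
    then show "x \<in> range num"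
      by induction (auto simp: R_def num_Suc[symmetric])
  next
    fix x assume "x \<in> range num"
    then obtain n where n: "x = num n" by blast
    have "(num 0, num n) \<in> R\<^sup>* \<and> num n \<in> W"
    proof (induction n)
      case (Suc n)
      then have "(num n, num (Suc n)) \<in> R" by (auto simp: R_def num_Suc)
      with Suc show ?case by (auto simp: num_Suc Wsc intro: rtrancl_into_rtrancl)
    qed (simp add: W0)
    with n show "(num 0, x) \<in> R\<^sup>*" by simp
  qed
  finally show ?thesis .
qed

lemma num_Nums [simp, intro]: "num n \<in> Nums"
  by (simp add: Nums_def)

lemma bex_Nums: "(\<exists>x\<in>Nums. P x) \<longleftrightarrow> (\<exists>n. P (num n))"
  by (auto simp: Nums_def)

abbreviation opair_product (infixr "\<otimes>" 80) where
  "X \<otimes> Y \<equiv> {opair x y |x y. x \<in> X \<and> y \<in> Y}"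

text \<open>
  Cantor's enumeration of the pairs of numbers is traversed step by step: \<open>(a, b + 1)\<close> is followed
  by \<open>(a + 1, b)\<close>, and \<open>(a, 0)\<close>, the end of a diagonal, by \<open>(0, a + 1)\<close>.
\<close>
lemma V_set_prod_encode:
  "V_set {opair (num (prod_encode (a, b))) (opair (num a) (num b)) |a b. True}" (is "V_set ?PE")
proof -
  let ?X = "Nums \<otimes> (Nums \<otimes> Nums)"
  define tr where "tr m a b = opair (num m) (opair (num a) (num b))" for m a b
  define R where "R = {(tr m a (Suc b), tr (Suc m) (Suc a) b) |m a b. True} \<union>
    {(tr m a 0, tr (Suc m) 0 (Suc a)) |m a. True}"
  have X: "V_set ?X" by (intro V_set_times V_set_Nums)
  have tr_X: "tr m a b \<in> ?X" for m a b unfolding tr_def by blast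
  have RX: "R \<subseteq> ?X \<times> ?X" using tr_X by (auto simp: R_def)
  have R: "V_set {opair x y |x y. (x, y) \<in> R}"
  proof -
    have "V_set {z\<in>?X \<otimes> ?X.
        (\<exists>m\<in>Nums. \<exists>a\<in>Nums. \<exists>b\<in>Nums. z = opair (opair m (opair a (succ b))) (opair (succ m) (opair (succ a) b))) \<or>
        (\<exists>m\<in>Nums. \<exists>a\<in>Nums. z = opair (opair m (opair a (num 0))) (opair (succ m) (opair (num 0) (succ a))))}"
      by (rule V_set_separation) (intro V_set_times X V_set_Nums definable_intros num_V)+
    also have "\<dots> = {z\<in>?X \<otimes> ?X. (\<exists>m a b. z = opair (tr m a (Suc b)) (tr (Suc m) (Suc a) b)) \<or>
        (\<exists>m a. z = opair (tr m a 0) (tr (Suc m) 0 (Suc a)))}"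
      by (simp only: bex_Nums tr_def num_Suc)
    also have "\<dots> = {opair x y |x y. (x, y) \<in> R}"
      unfolding R_def using tr_X by blast
    finally show ?thesis .
  qed
  \<comment> \<open>the index in the enumeration increases, so \<open>R\<close> is well-founded\<close>
  define f where "f z = (THE m. \<exists>a b. z = tr m a b)" for z
  have f: "f (tr m a b) = m" for m a b
    unfolding f_def tr_def by (rule the_equality) auto
  have "R \<subseteq> inv_image less_than f"
    by (auto simp: R_def f)
  then have "wf R" using wf_subset[OF wf_inv_image[OF wf_less_than]] by blast
  with X R RX tr_X have "V_set {x. (tr 0 0 0, x) \<in> R\<^sup>*}" by (intro V_set_reachable)
  also have "{x. (tr 0 0 0, x) \<in> R\<^sup>*} = ?PE"
  proof (intro set_eqI iffI; unfold mem_Collect_eq)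
    fix x assume "(tr 0 0 0, x) \<in> R\<^sup>*"
    then have "\<exists>a b. x = tr (prod_encode (a, b)) a b"
    proof induction
      case base
      then show ?case by (intro exI[of _ 0]) (simp add: prod_encode_def)
    next
      case (step y z)
      then obtain a b where y: "y = tr (prod_encode (a, b)) a b" by blast
      have tr_inj: "tr m a b = tr m' a' b' \<longleftrightarrow> m = m' \<and> a = a' \<and> b = b'" for m a b m' a' b'
        by (simp add: tr_def)
      have "z = tr (Suc (prod_encode (a, b))) (Suc a) (b - 1) \<and> b > 0 \<or>
          z = tr (Suc (prod_encode (a, b))) 0 (Suc a) \<and> b = 0"
        using step(2) unfolding R_def y by (auto simp: tr_inj)
      then show ?case
      proof
        assume *: "z = tr (Suc (prod_encode (a, b))) (Suc a) (b - 1) \<and> b > 0"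
        then have "Suc (prod_encode (a, b)) = prod_encode (Suc a, b - 1)"
          by (cases b) (auto simp: prod_encode_def)
        then show ?thesis using * by metis
      next
        assume *: "z = tr (Suc (prod_encode (a, b))) 0 (Suc a) \<and> b = 0"
        then have "Suc (prod_encode (a, b)) = prod_encode (0, Suc a)"
          by (simp add: prod_encode_def)
        then show ?thesis using * by metis
      qed
    qed
    then show "\<exists>a b. x = opair (num (prod_encode (a, b))) (opair (num a) (num b)) \<and> True"
      by (simp add: tr_def)
  next
    have "(tr 0 0 0, tr (prod_encode (a, b)) a b) \<in> R\<^sup>*" for a b
    proof (induction "prod_encode (a, b)" arbitrary: a b)
      case 0
      have "prod_encode (0, 0) = 0" by (simp add: prod_encode_def)
      with 0 have "a = 0 \<and> b = 0" by (metis prod_encode_eq prod.inject)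
      then show ?case by (simp add: prod_encode_def)
    next
      case (Suc m)
      show ?case
      proof (cases a)
        case 0
        then obtain b' where b: "b = Suc b'" using Suc(2) by (cases b) (auto simp: prod_encode_def)
        then have m: "m = prod_encode (b', 0)" using Suc(2) 0 by (simp add: prod_encode_def)
        have "(tr m b' 0, tr (Suc m) 0 (Suc b')) \<in> R" unfolding R_def by blast
        then show ?thesis using Suc(1)[OF m] Suc(2) m 0 b
          by (metis rtrancl.rtrancl_into_rtrancl)
      next
        case a: (Suc a')
        then have m: "m = prod_encode (a', Suc b)" using Suc(2) by (simp add: prod_encode_def)
        have "(tr m a' (Suc b), tr (Suc m) (Suc a') b) \<in> R" unfolding R_def by blast
        then show ?thesis using Suc(1)[OF m] Suc(2) m a
          by (metis rtrancl.rtrancl_into_rtrancl)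
      qed
    qed
    moreover fix x assume "\<exists>a b. x = opair (num (prod_encode (a, b))) (opair (num a) (num b)) \<and> True"
    ultimately show "(tr 0 0 0, x) \<in> R\<^sup>*" by (auto simp: tr_def)
  qed
  finally show ?thesis .
qed

section \<open>Integers as reals of the universe\<close>

text \<open>
  Addition and multiplication by \<open>k\<close> in one table, reached from \<open>(0, 0)\<close> by incrementing \<open>b\<close> or \<open>c\<close>.
\<close>
lemma V_set_linear:
  "V_set {opair (opair (num b) (num c)) (num (b + k * c)) |b c. True}" (is "V_set ?L")
proof -
  let ?X = "(Nums \<otimes> Nums) \<otimes> Nums"
  define tr where "tr b c s = opair (opair (num b) (num c)) (num s)" for b c s
  define R where "R = {(tr b c s, tr (Suc b) c (Suc s)) |b c s. True} \<union>
    {(tr b c s, tr b (Suc c) (s + k)) |b c s. True}"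
  have X: "V_set ?X" by (intro V_set_times V_set_Nums)
  have tr_X: "tr b c s \<in> ?X" for b c s unfolding tr_def by blast
  have RX: "R \<subseteq> ?X \<times> ?X" using tr_X by (auto simp: R_def)
  have tr_inj: "tr b c s = tr b' c' s' \<longleftrightarrow> b = b' \<and> c = c' \<and> s = s'" for b c s b' c' s'
    by (simp add: tr_def)
  have R: "V_set {opair x y |x y. (x, y) \<in> R}"
  proof -
    have "V_set {z\<in>?X \<otimes> ?X.
        (\<exists>b\<in>Nums. \<exists>c\<in>Nums. \<exists>s\<in>Nums. z = opair (opair (opair b c) s) (opair (opair (succ b) c) (succ s))) \<or>
        (\<exists>b\<in>Nums. \<exists>c\<in>Nums. \<exists>s\<in>Nums. z = opair (opair (opair b c) s) (opair (opair b (succ c)) ((succ ^^ k) s)))}"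
      by (rule V_set_separation) (intro V_set_times X V_set_Nums definable_intros num_V)+
    also have "\<dots> = {z\<in>?X \<otimes> ?X. (\<exists>b c s. z = opair (tr b c s) (tr (Suc b) c (Suc s))) \<or>
        (\<exists>b c s. z = opair (tr b c s) (tr b (Suc c) (s + k)))}"
      by (simp only: bex_Nums tr_def num_Suc succ_pow_num)
    also have "\<dots> = {opair x y |x y. (x, y) \<in> R}"
      unfolding R_def using tr_X by blast
    finally show ?thesis .
  qed
  define f where "f z = (THE m. \<exists>b c s. z = tr b c s \<and> m = b + c)" for z
  have f: "f (tr b c s) = b + c" for b c s
    unfolding f_def by (rule the_equality) (auto simp: tr_inj)
  have "R \<subseteq> inv_image less_than f"
    by (auto simp: R_def f)
  then have "wf R" using wf_subset[OF wf_inv_image[OF wf_less_than]] by blast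
  with X R RX tr_X have "V_set {x. (tr 0 0 0, x) \<in> R\<^sup>*}" by (intro V_set_reachable)
  also have "{x. (tr 0 0 0, x) \<in> R\<^sup>*} = {tr b c (b + k * c) |b c. True}"
  proof (intro set_eqI iffI; unfold mem_Collect_eq)
    fix x assume "(tr 0 0 0, x) \<in> R\<^sup>*"
    then show "\<exists>b c. x = tr b c (b + k * c) \<and> True"
    proof induction
      case base
      have "tr 0 0 0 = tr 0 0 (0 + k * 0)" by simp
      then show ?case by blast
    next
      case (step y z)
      then obtain b c where y: "y = tr b c (b + k * c)" by blast
      have "z = tr (Suc b) c (Suc b + k * c) \<or> z = tr b (Suc c) (b + k * Suc c)"
        using step(2) unfolding R_def y by (auto simp: tr_inj)
      then show ?case by blast
    qed
  next
    have *: "(tr 0 0 0, tr b 0 b) \<in> R\<^sup>*" for b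
    proof (induction b)
      case (Suc b)
      have "(tr b 0 b, tr (Suc b) 0 (Suc b)) \<in> R" unfolding R_def by blast
      with Suc show ?case by (rule rtrancl_into_rtrancl)
    qed simp
    have "(tr 0 0 0, tr b c (b + k * c)) \<in> R\<^sup>*" for b c
    proof (induction c)
      case (Suc c)
      have "(tr b c (b + k * c), tr b (Suc c) (b + k * c + k)) \<in> R" unfolding R_def by blast
      with Suc show ?case by (simp add: algebra_simps rtrancl_into_rtrancl)
    qed (simp add: *)
    moreover fix x assume "\<exists>b c. x = tr b c (b + k * c) \<and> True"
    ultimately show "(tr 0 0 0, x) \<in> R\<^sup>*" by auto
  qed
  finally show ?thesis by (simp add: tr_def)
qed

text \<open>
  The Dedekind cuts of \<open>k\<close> and of \<open>- k\<close>: the inequality \<open>(a - b) / (c + 1) < \<plusminus> k\<close> is cleared of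
  denominators and of negative terms.
\<close>
lemma V_set_linear_less:
  "V_set {opair (num a) (opair (num b) (num c)) |a b c. a < b + k * Suc c}"
  "V_set {opair (num a) (opair (num b) (num c)) |a b c. a + k * Suc c < b}"
proof -
  let ?X = "Nums \<otimes> (Nums \<otimes> Nums)"
  define L where "L = {opair (opair (num b) (num c)) (num (b + k * c)) |b c. True}"
  have L: "V_set L" unfolding L_def by (rule V_set_linear)
  have L_iff: "opair (opair (num b) (num c)) (num s) \<in> L \<longleftrightarrow> s = b + k * c" for b c s
    by (auto simp: L_def)
  have X: "V_set ?X" by (intro V_set_times V_set_Nums)
  have "V_set {z\<in>?X. \<exists>a\<in>Nums. \<exists>b\<in>Nums. \<exists>c\<in>Nums. \<exists>s\<in>Nums. z = opair a (opair b c) \<and>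
      opair (opair b (succ c)) s \<in> L \<and> E a s}"
    by (rule V_set_separation) (intro X L V_set_Nums definable_intros)+
  also have "\<dots> = {opair (num a) (opair (num b) (num c)) |a b c. a < b + k * Suc c}"
    by (auto simp only: bex_Nums num_Suc[symmetric] L_iff num_mem_iff; blast)
  finally show "V_set {opair (num a) (opair (num b) (num c)) |a b c. a < b + k * Suc c}" .
  have "V_set {z\<in>?X. \<exists>a\<in>Nums. \<exists>b\<in>Nums. \<exists>c\<in>Nums. \<exists>s\<in>Nums. z = opair a (opair b c) \<and>
      opair (opair a (succ c)) s \<in> L \<and> E s b}"
    by (rule V_set_separation) (intro X L V_set_Nums definable_intros)+
  also have "\<dots> = {opair (num a) (opair (num b) (num c)) |a b c. a + k * Suc c < b}"
    by (auto simp only: bex_Nums num_Suc[symmetric] L_iff num_mem_iff; blast)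
  finally show "V_set {opair (num a) (opair (num b) (num c)) |a b c. a + k * Suc c < b}" .
qed

text \<open>
  An integer is rational, so its Dedekind cut is definable by arithmetic alone; hence it lies
  in \<open>V\<close>, and so in the universe.
\<close>
lemma Ints_subset_reals_of: "\<int> \<subseteq> reals_of E"
proof
  fix x :: real assume "x \<in> \<int>"
  then obtain m :: int where x: "x = of_int m" by (auto elim: Ints_cases)
  have cut: "{t. \<exists>a b c a' b' c' p. (real a - real b) / (real c + 1) < x \<and>
      is_num E a a' \<and> is_num E b b' \<and> is_num E c c' \<and> is_pair E b' c' p \<and> is_pair E a' p t} =
    {opair (num a) (opair (num b) (num c)) |a b c. int a - int b < m * int (Suc c)}"
  proof -
    have "(real a - real b) / (real c + 1) < x \<longleftrightarrow> int a - int b < m * int (Suc c)" for a b c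
    proof -
      have "(real a - real b) / (real c + 1) < x \<longleftrightarrow> real a - real b < of_int m * (real c + 1)"
        by (simp add: x pos_divide_less_eq)
      also have "\<dots> \<longleftrightarrow> real_of_int (int a - int b) < real_of_int (m * int (Suc c))"
        by (simp add: algebra_simps)
      finally show ?thesis by (simp only: of_int_less_iff)
    qed
    moreover have "(\<exists>a' b' c' p. is_num E a a' \<and> is_num E b b' \<and> is_num E c c' \<and> is_pair E b' c' p \<and>
        is_pair E a' p t) \<longleftrightarrow> t = opair (num a) (opair (num b) (num c))" for a b c t
      by (simp add: is_num_iff is_pair_iff)
    ultimately show ?thesis by (simp only: ex_simps) blast
  qed
  have "V_set {opair (num a) (opair (num b) (num c)) |a b c. int a - int b < m * int (Suc c)}"
  proof (cases "m \<ge> 0")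
    case True
    then obtain k where m: "m = int k" using nonneg_int_cases by blast
    have "int a - int b < m * int (Suc c) \<longleftrightarrow> a < b + k * Suc c" for a b c
    proof -
      have "int a - int b < m * int (Suc c) \<longleftrightarrow> int a < int (b + k * Suc c)"
        by (simp add: m algebra_simps)
      then show ?thesis by (simp only: of_nat_less_iff)
    qed
    then show ?thesis using V_set_linear_less(1)[of k] by presburger
  next
    case False
    then obtain k where m: "m = - int k" using int_cases3 by (metis less_eq_int_code(1) linorder_not_le neg_int_cases)
    have "int a - int b < m * int (Suc c) \<longleftrightarrow> a + k * Suc c < b" for a b c
    proof -
      have "int a - int b < m * int (Suc c) \<longleftrightarrow> int (a + k * Suc c) < int b"
        by (simp add: m algebra_simps)
      then show ?thesis by (simp only: of_nat_less_iff)
    qed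
    then show ?thesis using V_set_linear_less(2)[of k] by presburger
  qed
  then show "x \<in> reals_of E"
    unfolding reals_of_def mem_Collect_eq cut V_set_def by blast
qed

end

section \<open>Borel codes of intersections with cylinders\<close>

lemma borel_code_complementE:
  assumes "borel_code c A" "c 0 = 1"
  obtains B where "A = - B" "borel_code (\<lambda>k. c (Suc k)) B"
  using assms by (cases rule: borel_code.cases) auto

lemma borel_code_unionE:
  assumes "borel_code c A" "c 0 \<ge> 2"
  obtains B where "A = (\<Union>n. B n)" "\<And>n. borel_code (\<lambda>k. c (Suc (prod_encode (n, k)))) (B n)"
  using assms by (cases rule: borel_code.cases) auto

lemma borel_code_subbasicE:
  assumes "borel_code c A" "c 0 = 0"
  shows "A = {x. x (c 1)}"
  using assms by (cases rule: borel_code.cases) auto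

text \<open>
  The place at which a code \<open>c\<close> of the form \<open>- (\<Union>j. B j)\<close> keeps the entry \<open>k\<close> of the code of \<open>B j\<close>: one
  place is taken by the entry for the complement and one by the entry for the union.
\<close>
definition branch :: "nat \<Rightarrow> nat \<Rightarrow> nat" where
  "branch j k = Suc (Suc (prod_encode (j, k)))"

text \<open>
  Inclusion in a subbasic set is recognised from five entries of the code, at places that depend only on \<open>j\<close>: they say
  that the coded set is of the form \<open>- (\<Union>j. B j)\<close> where one \<open>B j\<close> is the complement of the
  subbasic set. The dense set for random forcing is described by such entries.
\<close>
lemma borel_code_subset_subbasic:
  assumes A: "borel_code c A" and c: "c 0 = 1" "c 1 = 2"
    and j: "c (branch j 0) = 1" "c (branch j 1) = 0"
  shows "A \<subseteq> {x. x (c (branch j 2))}"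
proof -
  obtain B where B: "A = - B" "borel_code (\<lambda>k. c (Suc k)) B"
    using borel_code_complementE A c by blast
  obtain C where C: "B = (\<Union>n. C n)"
    "\<And>n. borel_code (\<lambda>k. c (Suc (Suc (prod_encode (n, k))))) (C n)"
    by (rule borel_code_unionE[OF B(2)]) (use c in auto)
  obtain D where D: "C j = - D" "borel_code (\<lambda>k. c (Suc (Suc (prod_encode (j, Suc k))))) D"
    by (rule borel_code_complementE[OF C(2)[of j]]) (use j in \<open>auto simp: branch_def\<close>)
  have "D = {x. x (c (branch j 2))}"
    using borel_code_subbasicE[OF D(2)] j by (simp add: branch_def numeral_2_eq_2)
  then show ?thesis using B C D by auto
qed

text \<open>
  The code of the \<open>j\<close>-th set in the union of which \<open>A \<inter> {x. x a} \<inter> {x. x b}\<close> is the complement, if \<open>c\<close>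
  codes \<open>A\<close>. That set is \<open>- A\<close> for \<open>j = 0\<close>, \<open>- {x. x a}\<close> for \<open>j = 1\<close>, and \<open>- {x. x b}\<close>, repeated,
  for all \<open>j \<ge> 2\<close>. Every entry of the code of a subbasic set after the first may be taken to be
  the index, since only the second one matters.
\<close>
definition meet_code_branch :: "(nat \<Rightarrow> nat) \<Rightarrow> nat \<Rightarrow> nat \<Rightarrow> nat \<Rightarrow> nat \<Rightarrow> nat" where
  "meet_code_branch c a b j k =
     (if k = 0 then 1 else if j = 0 then c (k - 1) else if k = 1 then 0
      else if j = 1 then a else b)"

definition meet_code :: "(nat \<Rightarrow> nat) \<Rightarrow> nat \<Rightarrow> nat \<Rightarrow> nat \<Rightarrow> nat" where
  "meet_code c a b m =
     (if m = 0 then 1 else if m = 1 then 2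
      else case prod_decode (m - 2) of (j, k) \<Rightarrow> meet_code_branch c a b j k)"

lemma meet_code_simps [simp]:
  "meet_code c a b 0 = 1" "meet_code c a b (Suc 0) = 2"
  "meet_code c a b (Suc (Suc (prod_encode (j, k)))) = meet_code_branch c a b j k"
  by (simp_all add: meet_code_def)

lemma borel_code_meet:
  assumes "borel_code c A"
  shows "borel_code (meet_code c a b) (A \<inter> {x. x a} \<inter> {x. x b})"
proof -
  define B where "B n = - (if n = 0 then A else if n = 1 then {x. x a} else {x. x b})" for n :: nat
  have branch: "borel_code (\<lambda>k. meet_code_branch c a b n k) (B n)" for n
    unfolding B_def
  proof (rule borel_code.complement)
    have sub: "borel_code d {x. x i}" if "d 0 = 0" "d 1 = i" for d i
      using borel_code.subbasic[of d] that by simp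
    show "borel_code (\<lambda>k. meet_code_branch c a b n (Suc k))
        (if n = 0 then A else if n = 1 then {x. x a} else {x. x b})"
      using assms by (auto simp: meet_code_branch_def intro!: sub)
  qed (simp add: meet_code_branch_def)
  have "borel_code (meet_code c a b) (- (\<Union>n. B n))"
    by (intro borel_code.complement borel_code.union) (use branch in simp_all)
  also have "- (\<Union>n. B n) = A \<inter> {x. x a} \<inter> {x. x b}"
  proof -
    have "(\<Union>n. B n) = B 0 \<union> B 1 \<union> B 2"
    proof -
      have "B n \<subseteq> B 0 \<union> B 1 \<union> B 2" for n by (auto simp: B_def)
      then show ?thesis by blast
    qed
    then show ?thesis by (simp add: B_def)
  qed
  finally show ?thesis .
qed

section \<open>Pairs of ones at a given distance\<close>

lemma space_coin_measure: "space coin_measure = UNIV"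
  by (auto simp: coin_measure_def space_PiM space_uniform_count_measure)

lemma subbasic_sets: "{x. x i} \<in> sets coin_measure"
proof -
  have "(\<lambda>x. x i) \<in> measurable coin_measure (uniform_count_measure UNIV)"
    unfolding coin_measure_def by (rule measurable_component_singleton) simp
  then have "(\<lambda>x. x i) -` {True} \<inter> space coin_measure \<in> sets coin_measure"
    by (rule measurable_sets) simp
  then show ?thesis by (simp add: space_coin_measure vimage_def)
qed

lemma borel_code_sets: "borel_code c A \<Longrightarrow> A \<in> sets coin_measure"
proof (induction rule: borel_code.induct)
  case (complement c A)
  then show ?case
    using sets.compl_sets[of A coin_measure] by (simp add: space_coin_measure Compl_eq_Diff_UNIV)
qed (auto intro: subbasic_sets)

lemma prob_space_uniform_bool: "prob_space (uniform_count_measure (UNIV :: bool set))"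
  by (rule prob_space_uniform_count_measure) auto

lemma cylinder_prob:
  assumes "finite J"
  shows "measure coin_measure {x. \<forall>j\<in>J. x j = f j} = (1 / 2) ^ card J"
proof -
  interpret product_prob_space "\<lambda>_::nat. uniform_count_measure (UNIV :: bool set)" UNIV
    by (intro product_prob_spaceI prob_space_uniform_bool)
  have half: "emeasure (uniform_count_measure (UNIV :: bool set)) {b} = ennreal (1 / 2)" for b
    by (simp add: emeasure_uniform_count_measure)
  have "{x. \<forall>j\<in>J. x j = f j} = {x\<in>space coin_measure. \<forall>j\<in>J. x j \<in> {f j}}"
    unfolding space_coin_measure by simp
  then have "emeasure coin_measure {x. \<forall>j\<in>J. x j = f j} =
      emeasure coin_measure {x\<in>space coin_measure. \<forall>j\<in>J. x j \<in> {f j}}"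
    by (rule arg_cong)
  also have "\<dots> = (\<Prod>j\<in>J. emeasure (uniform_count_measure (UNIV :: bool set)) {f j})"
    unfolding coin_measure_def using assms
    by (intro emeasure_PiM_Collect) (simp_all add: sets_uniform_count_measure)
  also have "\<dots> = ennreal ((1 / 2) ^ card J)"
    unfolding half prod_constant by (rule ennreal_power) simp
  finally show ?thesis by (simp add: measure_def)
qed

text \<open>
  The pairs \<open>{2 l n, 2 l n + n}\<close> for \<open>l < K\<close> are disjoint. A point of the set avoids the value
  \<open>(1, 1)\<close> on each of them, so it lies in one of the \<open>3\<^sup>K\<close> cylinders given by the other three values,
  each of measure \<open>4\<^sup>-\<^sup>K\<close>.
\<close>
lemma null_no_shift:
  assumes n: "n > 0"
  shows "{x. \<forall>i. \<not> (x i \<and> x (i + n))} \<in> null_sets coin_measure" (is "?N \<in> _")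
proof -
  interpret prob_space coin_measure
    unfolding coin_measure_def by (intro prob_space_PiM prob_space_uniform_bool)
  have "?N = space coin_measure - (\<Union>i. {x. x i} \<inter> {x. x (i + n)})"
    by (auto simp: space_coin_measure)
  also have "\<dots> \<in> sets coin_measure"
    by (intro sets.Diff sets.top sets.countable_UN sets.Int) (auto intro: subbasic_sets)
  finally have N: "?N \<in> sets coin_measure" .
  have bound: "prob ?N \<le> (3 / 4) ^ K" for K
  proof -
    define J where "J = (\<lambda>m. m * n) ` {..<2 * K}"
    define F where "F = ({..<K} \<rightarrow>\<^sub>E {(False, False), (False, True), (True, False)})"
    \<comment> \<open>the value at the place \<open>j\<close> prescribed by the values \<open>f l\<close> on the pairs\<close>
    define w where "w f j = (let m = j div n in if even m then fst (f (m div 2)) else snd (f (m div 2)))"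
      for f :: "nat \<Rightarrow> bool \<times> bool" and j
    define C where "C f = {x. \<forall>j\<in>J. x j = w f j}" for f
    have J: "finite J" "card J = 2 * K"
      using n by (auto simp: J_def card_image inj_on_def)
    have F: "finite F" "card F = 3 ^ K"
      by (auto simp: F_def card_PiE numeral_3_eq_3 intro!: finite_PiE)
    have C: "C f \<in> events" for f
    proof -
      have "C f = (\<Inter>j\<in>J. {x\<in>space coin_measure. x j = w f j}) \<inter> space coin_measure"
        by (auto simp: C_def space_coin_measure)
      also have "{x\<in>space coin_measure. x j = w f j} \<in> events" for j
      proof (cases "w f j")
        case True
        then show ?thesis using subbasic_sets[of j] by (simp add: space_coin_measure)
      next
        case False
        then have "{x\<in>space coin_measure. x j = w f j} = space coin_measure - {x. x j}" by auto
        then show ?thesis using subbasic_sets[of j] by auto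
      qed
      then have "(\<Inter>j\<in>J. {x\<in>space coin_measure. x j = w f j}) \<inter> space coin_measure \<in> events"
        using J(1) by (cases "J = {}") (auto intro!: sets.finite_INT)
      finally show ?thesis .
    qed
    have "?N \<subseteq> (\<Union>f\<in>F. C f)"
    proof
      fix x assume x: "x \<in> ?N"
      define f where "f = (\<lambda>l\<in>{..<K}. (x (2 * l * n), x (2 * l * n + n)))"
      have "f \<in> F"
        using x by (auto simp: f_def F_def)
      moreover have "x \<in> C f"
        unfolding C_def J_def
      proof (intro CollectI ballI)
        fix j assume "j \<in> (\<lambda>m. m * n) ` {..<2 * K}"
        then obtain m where m: "j = m * n" "m < 2 * K" by auto
        have "w f j = (if even m then fst (f (m div 2)) else snd (f (m div 2)))"
          using n by (simp add: w_def m)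
        also have "\<dots> = x j"
          using m by (auto simp: f_def elim!: evenE oddE) (simp_all add: algebra_simps)
        finally show "x j = w f j" ..
      qed
      ultimately show "x \<in> (\<Union>f\<in>F. C f)" by blast
    qed
    then have "prob ?N \<le> prob (\<Union>f\<in>F. C f)"
      using F(1) C by (intro finite_measure_mono) auto
    also have "\<dots> \<le> (\<Sum>f\<in>F. prob (C f))"
      using F(1) C by (intro finite_measure_subadditive_finite) auto
    also have "\<dots> = 3 ^ K * (1 / 2) ^ (2 * K)"
      using F(2) J by (simp add: C_def cylinder_prob)
    also have "\<dots> = (3 / 4) ^ K"
      by (simp add: power_mult power2_eq_square flip: power_mult_distrib)
    finally show ?thesis .
  qed
  have "prob ?N = 0"
  proof (rule ccontr)
    assume "prob ?N \<noteq> 0"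
    then have "prob ?N > 0" using zero_less_measure_iff by blast
    then obtain K where "(3 / 4) ^ K < prob ?N"
      using real_arch_pow_inv[of "prob ?N" "3 / 4"] by auto
    then show False using bound[of K] by simp
  qed
  then show ?thesis using N by (simp add: null_setsI emeasure_eq_measure)
qed

lemma nonnull_Int_shift:
  assumes "A \<in> sets coin_measure" "A \<notin> null_sets coin_measure" "n > 0"
  shows "\<exists>i. A \<inter> {x. x i} \<inter> {x. x (i + n)} \<notin> null_sets coin_measure"
proof (rule ccontr)
  let ?N = "{x. \<forall>i. \<not> (x i \<and> x (i + n))}"
  assume "\<not> ?thesis"
  then have "(\<Union>i. A \<inter> {x. x i} \<inter> {x. x (i + n)}) \<union> ?N \<in> null_sets coin_measure"
    using null_no_shift[OF assms(3)] by (intro null_sets.Un null_sets_UN) auto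
  moreover have "A \<subseteq> (\<Union>i. A \<inter> {x. x i} \<inter> {x. x (i + n)}) \<union> ?N" by blast
  ultimately show False using assms(1,2) null_sets_subset by blast
qed

section \<open>Generic reals contain pairs at every distance\<close>

context transitive_ZFC_class
begin

lemma graph_class_eq: "graph_class E f = {opair (num i) (num j) |i j. f i = Some j}"
proof -
  have "(\<exists>a b. f i = Some j \<and> is_num E i a \<and> is_num E j b \<and> is_pair E a b p) \<longleftrightarrow>
      f i = Some j \<and> p = opair (num i) (num j)" for i j p
    by (simp add: is_num_iff is_pair_iff)
  then show ?thesis unfolding graph_class_def by blast
qed

lemma opair_graph_iff: "opair (num i) (num j) \<in> graph_class E f \<longleftrightarrow> f i = Some j"
  by (auto simp: graph_class_eq)

lemma graph_class_subset: "graph_class E f \<subseteq> Nums \<otimes> Nums"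
  by (auto simp: graph_class_eq)

lemma generic_meets:
  assumes "generic_filter E V P le G" "V_set D" "\<And>p. p \<in> P \<Longrightarrow> \<exists>q\<in>P. q \<in> D \<and> le q p"
  shows "\<exists>p\<in>G. p \<in> P \<and> p \<in> D"
proof -
  obtain d where d: "d \<in> V" "elts E d = D" using assms(2) by (auto simp: V_set_def)
  have "\<forall>p\<in>P. \<exists>q\<in>P \<inter> elts E d. le q p" using assms(3) d(2) by blast
  then have "G \<inter> elts E d \<noteq> {}" using assms(1) d(1) unfolding generic_filter_def by blast
  moreover have "G \<subseteq> P" using assms(1) unfolding generic_filter_def by blast
  ultimately show ?thesis using d(2) by blast
qed

text \<open>
  A set of \<open>V\<close> that contains all Cohen conditions and all Borel codes of \<open>V\<close>; the dense sets are
  separated from it.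
\<close>
definition Rels :: "'v set" where
  "Rels = {w\<in>V. elts E w \<subseteq> Nums \<otimes> Nums}"

lemma V_set_Rels: "V_set Rels"
  unfolding Rels_def by (intro V_set_Pow V_set_times V_set_Nums)

lemma cohen_shift:
  assumes "cohen_real E V G r"
  shows "\<exists>i. r i \<and> r (i + n)"
proof -
  define D where "D = {u\<in>Rels. \<exists>i\<in>Nums. E (opair i (num 1)) u \<and> E (opair ((succ ^^ n) i) (num 1)) u}"
  have D_iff: "u \<in> D \<longleftrightarrow> u \<in> Rels \<and>
      (\<exists>i. opair (num i) (num 1) \<in> elts E u \<and> opair (num (i + n)) (num 1) \<in> elts E u)" for u
    by (simp add: D_def bex_Nums succ_pow_num elts_def)
  have D: "V_set D"
    unfolding D_def by (rule V_set_separation) (intro V_set_Rels V_set_Nums definable_intros num_V)+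
  have dense: "\<exists>q\<in>cohen_conds E V. q \<in> D \<and> cohen_le E q p" if p: "p \<in> cohen_conds E V" for p
  proof -
    obtain s :: "bool list" where s: "elts E p =
        graph_class E (\<lambda>i. if i < length s then Some (of_bool (s ! i)) else None)"
      using p by (auto simp: cohen_conds_def)
    \<comment> \<open>ones at the places \<open>length s, \<dots>, length s + n\<close>\<close>
    define t where "t = s @ replicate (Suc n) True"
    define f where "f = (\<lambda>i. if i < length t then Some (of_bool (t ! i) :: nat) else None)"
    have f: "f i = Some j \<longleftrightarrow> i \<in> {..<length t} \<and> j = of_bool (t ! i)" for i j
      by (auto simp: f_def)
    have "graph_class E f = (\<lambda>i. opair (num i) (num (of_bool (t ! i)))) ` {..<length t}"
      unfolding graph_class_eq f by blast
    then have "V_set (graph_class E f)"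
      by (intro V_set_finite) auto
    then obtain q where q: "q \<in> V" "elts E q = graph_class E f" by (auto simp: V_set_def)
    have "q \<in> cohen_conds E V" using q by (auto simp: cohen_conds_def f_def)
    moreover have "cohen_le E q p"
      unfolding cohen_le_def s q by (auto simp: graph_class_eq f_def t_def nth_append split: if_splits)
    moreover have "q \<in> D"
    proof -
      have "opair (num i) (num 1) \<in> elts E q" if "i = length s \<or> i = length s + n" for i
        using that unfolding q opair_graph_iff by (auto simp: f_def t_def nth_append nth_Cons')
      moreover have "q \<in> Rels" using q graph_class_subset by (auto simp: Rels_def)
      ultimately show ?thesis unfolding D_iff by blast
    qed
    ultimately show ?thesis by blast
  qed
  have "generic_filter E V (cohen_conds E V) (cohen_le E) G"
    using assms by (simp add: cohen_real_def)
  from generic_meets[OF this D dense] obtain p where p: "p \<in> G" "p \<in> D"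
    by blast
  have "r i" if "opair (num i) (num 1) \<in> elts E p" for i
  proof -
    have "opair (num i) (num 1) \<in> graph_class E (\<lambda>i. Some (of_bool (r i)))"
      using assms p(1) that unfolding cohen_real_def by blast
    then have "Some (of_bool (r i)) = Some (1 :: nat)" by (simp only: opair_graph_iff)
    then show ?thesis by (simp add: of_bool_def split: if_splits)
  qed
  then show ?thesis using p(2) unfolding D_iff by blast
qed

text \<open>
  The arithmetical definition of the new code, with the old code and the graph of \<open>prod_encode\<close>
  as parameters.
\<close>
lemma V_set_meet_code:
  assumes "V_set (graph_class E (\<lambda>i. Some (c i)))"
  shows "V_set (graph_class E (\<lambda>i. Some (meet_code c a b i)))"
proof -
  define PE where "PE = {opair (num (prod_encode (j, k))) (opair (num j) (num k)) |j k. True}"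
  have PE: "V_set PE" unfolding PE_def by (rule V_set_prod_encode)
  have PE_iff: "opair (num m) (opair (num j) (num k)) \<in> PE \<longleftrightarrow> m = prod_encode (j, k)" for m j k
    by (auto simp: PE_def)
  define GC where "GC = graph_class E (\<lambda>i. Some (c i))"
  have GC_iff: "opair (num k) (num v) \<in> GC \<longleftrightarrow> v = c k" for k v
    by (auto simp: GC_def opair_graph_iff)
  have branch: "v = meet_code_branch c a b j k \<longleftrightarrow>
      k = 0 \<and> v = 1 \<or> j = 0 \<and> (\<exists>l. k = Suc l \<and> v = c l) \<or>
      j \<noteq> 0 \<and> k = 1 \<and> v = 0 \<or> j = 1 \<and> k \<noteq> 0 \<and> k \<noteq> 1 \<and> v = a \<or>
      j \<noteq> 0 \<and> j \<noteq> 1 \<and> k \<noteq> 0 \<and> k \<noteq> 1 \<and> v = b" for v j k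
    by (cases k) (auto simp: meet_code_branch_def)
  have "V_set {z\<in>Nums \<otimes> Nums. z = opair (num 0) (num 1) \<or> z = opair (num 1) (num 2) \<or>
    (\<exists>m\<in>Nums. \<exists>j\<in>Nums. \<exists>k\<in>Nums. \<exists>v\<in>Nums. z = opair (succ (succ m)) v \<and> opair m (opair j k) \<in> PE \<and>
      (k = num 0 \<and> v = num 1 \<or> j = num 0 \<and> (\<exists>l\<in>Nums. k = succ l \<and> opair l v \<in> GC) \<or>
      j \<noteq> num 0 \<and> k = num 1 \<and> v = num 0 \<or>
      j = num 1 \<and> k \<noteq> num 0 \<and> k \<noteq> num 1 \<and> v = num a \<or>
      j \<noteq> num 0 \<and> j \<noteq> num 1 \<and> k \<noteq> num 0 \<and> k \<noteq> num 1 \<and> v = num b))}"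
    by (rule V_set_separation)
      (intro V_set_times V_set_Nums PE assms[folded GC_def] definable_intros num_V opair_V)+
  also have "\<dots> = {z\<in>Nums \<otimes> Nums. z = opair (num 0) (num 1) \<or> z = opair (num 1) (num 2) \<or>
      (\<exists>m j k v. z = opair (num (Suc (Suc m))) (num v) \<and> m = prod_encode (j, k) \<and>
        v = meet_code_branch c a b j k)}"
    unfolding branch by (simp only: bex_Nums num_Suc[symmetric] num_inject PE_iff GC_iff)
  also have "\<dots> = graph_class E (\<lambda>i. Some (meet_code c a b i))"
  proof -
    let ?G = "graph_class E (\<lambda>i. Some (meet_code c a b i))"
    have "z \<in> ?G \<longleftrightarrow> z = opair (num 0) (num 1) \<or> z = opair (num 1) (num 2) \<or>
        (\<exists>m j k v. z = opair (num (Suc (Suc m))) (num v) \<and> m = prod_encode (j, k) \<and>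
          v = meet_code_branch c a b j k)" for z
    proof -
      have "z \<in> ?G \<longleftrightarrow> (\<exists>i. z = opair (num i) (num (meet_code c a b i)))"
        unfolding graph_class_eq option.inject by blast
      also have "\<dots> \<longleftrightarrow> z = opair (num 0) (num 1) \<or> z = opair (num 1) (num 2) \<or>
          (\<exists>m. z = opair (num (Suc (Suc m))) (num (meet_code c a b (Suc (Suc m)))))"
        by (metis One_nat_def meet_code_simps(1,2) not0_implies_Suc)
      also have "(\<exists>m. z = opair (num (Suc (Suc m))) (num (meet_code c a b (Suc (Suc m))))) \<longleftrightarrow>
          (\<exists>m j k v. z = opair (num (Suc (Suc m))) (num v) \<and> m = prod_encode (j, k) \<and>
            v = meet_code_branch c a b j k)"
        by (metis meet_code_simps(3) prod_decode_inverse surj_pair)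
      finally show ?thesis .
    qed
    then show ?thesis using graph_class_subset[of "\<lambda>i. Some (meet_code c a b i)"] by blast
  qed
  finally show ?thesis .
qed

text \<open>
  The dense set \<open>D\<close> consists of the codes recognisable, as in \<open>borel_code_subset_subbasic\<close>, as codes
  of subsets of \<open>{x. x i} \<inter> {x. x (i + n)}\<close> for some \<open>i\<close>. It is dense because of the codes
  \<open>meet_code\<close>. Membership in \<open>D\<close> concerns finitely many entries, so it is definable without
  any formalization of Borel sets or of the measure inside \<open>V\<close>.
\<close>
lemma random_shift:
  assumes r: "random_real E V G r" and n: "n > 0"
  shows "\<exists>i. r i \<and> r (i + n)"
proof -
  define forces where "forces u j i \<longleftrightarrow> E (opair (num (branch j 0)) (num 1)) u \<and>
    E (opair (num (branch j 1)) (num 0)) u \<and> E (opair (num (branch j 2)) i) u" for u j i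
  define D where "D = {u\<in>Rels. E (opair (num 0) (num 1)) u \<and> E (opair (num 1) (num 2)) u \<and>
    (\<exists>i\<in>Nums. forces u 1 i \<and> forces u 2 ((succ ^^ n) i))}"
  have D_iff: "u \<in> D \<longleftrightarrow> c 0 = 1 \<and> c 1 = 2 \<and>
      (\<exists>i. c (branch 1 0) = 1 \<and> c (branch 1 1) = 0 \<and> c (branch 1 2) = i \<and>
         c (branch 2 0) = 1 \<and> c (branch 2 1) = 0 \<and> c (branch 2 2) = i + n)"
    if "u \<in> V" "elts E u = graph_class E (\<lambda>i. Some (c i))" for u c
  proof -
    have "E (opair (num i) (num j)) u \<longleftrightarrow> c i = j" for i j
      using opair_graph_iff[of i j "\<lambda>i. Some (c i)"] that(2) by (auto simp: elts_def)
    moreover have "u \<in> Rels" using that graph_class_subset by (simp add: Rels_def)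
    ultimately show ?thesis by (simp add: D_def forces_def bex_Nums succ_pow_num)
  qed
  have D: "V_set D"
    unfolding D_def forces_def
    by (rule V_set_separation) (intro V_set_Rels V_set_Nums definable_intros num_V)+
  have dense: "\<exists>q\<in>random_conds E V. q \<in> D \<and> random_le E q p" if p: "p \<in> random_conds E V" for p
  proof -
    obtain A c where pV: "p \<in> V" and c: "elts E p = graph_class E (\<lambda>i. Some (c i))"
      and A: "borel_code c A" "A \<notin> null_sets coin_measure"
      using p by (auto simp: random_conds_def codes_borel_def)
    obtain i where i: "A \<inter> {x. x i} \<inter> {x. x (i + n)} \<notin> null_sets coin_measure"
      using nonnull_Int_shift[OF borel_code_sets[OF A(1)] A(2) n] by blast
    let ?c = "meet_code c i (i + n)" and ?B = "A \<inter> {x. x i} \<inter> {x. x (i + n)}"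
    obtain q where q: "q \<in> V" "elts E q = graph_class E (\<lambda>i. Some (?c i))"
      using V_set_meet_code[OF V_set_elts[OF pV, unfolded c], of i "i + n"] by (auto simp: V_set_def)
    have qB: "codes_borel E q ?B"
      unfolding codes_borel_def using q borel_code_meet[OF A(1)] by blast
    have "q \<in> random_conds E V" using q(1) qB i by (auto simp: random_conds_def)
    moreover have "random_le E q p"
    proof -
      have "codes_borel E p A" unfolding codes_borel_def using c A by blast
      moreover have "?B - A = {}" by blast
      ultimately show ?thesis unfolding random_le_def using qB by (metis null_sets.empty_sets)
    qed
    moreover have "q \<in> D"
      unfolding D_iff[OF q] by (simp add: branch_def meet_code_branch_def)
    ultimately show ?thesis by blast
  qed
  have "generic_filter E V (random_conds E V) (random_le E) G"
    using r by (simp add: random_real_def)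
  from generic_meets[OF this D dense] obtain p
    where p: "p \<in> G" "p \<in> random_conds E V" "p \<in> D"
    by blast
  then obtain A c where pV: "p \<in> V" and c: "elts E p = graph_class E (\<lambda>i. Some (c i))"
      and A: "borel_code c A"
    by (auto simp: random_conds_def codes_borel_def)
  have "codes_borel E p A" unfolding codes_borel_def using c A by blast
  then have "r \<in> A" using r p(1) unfolding random_real_def by blast
  moreover have "A \<subseteq> {x. x (c (branch 1 2))}" "A \<subseteq> {x. x (c (branch 2 2))}"
    using p(3) borel_code_subset_subbasic[OF A] unfolding D_iff[OF pV c] by blast+
  moreover have "c (branch 2 2) = c (branch 1 2) + n"
    using p(3) unfolding D_iff[OF pV c] by auto
  ultimately show ?thesis by auto
qed

end

lemma Ints_definable:
  fixes r :: "nat \<Rightarrow> bool"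
  assumes R: "\<int> \<subseteq> R" and shift: "\<And>n. \<exists>i. r i \<and> r (i + n)"
  shows "definable_in R {real n |n. r n} \<int>"
proof -
  let ?U = "{real n |n. r n}"
  let ?\<phi> = "FEx 1 (FEx 2 (FAnd (FPred (TVar 1)) (FAnd (FPred (TVar 2))
    (FEq (TAdd (TVar 0) (TVar 1)) (TVar 2)))))"
  have U: "?U \<subseteq> R" using R by auto
  have sat: "fm_sat R ?U ((\<lambda>_. 0)(0 := x)) ?\<phi> \<longleftrightarrow> (\<exists>a\<in>?U. \<exists>b\<in>?U. x + a = b)" for x
    using U by auto
  have "x \<in> \<int> \<longleftrightarrow> (\<exists>a\<in>?U. \<exists>b\<in>?U. x + a = b)" for x
  proof
    assume "x \<in> \<int>"
    then obtain m where m: "x = of_int m" by (auto elim: Ints_cases)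
    obtain i where i: "r i" "r (i + nat \<bar>m\<bar>)" using shift by blast
    show "\<exists>a\<in>?U. \<exists>b\<in>?U. x + a = b"
    proof (cases "m \<ge> 0")
      case True
      then have "x + real i = real (i + nat \<bar>m\<bar>)" by (simp add: m)
      then show ?thesis using i by blast
    next
      case False
      then have "x + real (i + nat \<bar>m\<bar>) = real i" by (simp add: m)
      then show ?thesis using i by blast
    qed
  next
    assume "\<exists>a\<in>?U. \<exists>b\<in>?U. x + a = b"
    then obtain a b where "x = real b - real a" by (auto simp: eq_diff_eq)
    then show "x \<in> \<int>" by simp
  qed
  then have "\<int> = {x\<in>R. fm_sat R ?U ((\<lambda>_. 0)(0 := x)) ?\<phi>}"
    using R unfolding sat by blast
  moreover have "range (\<lambda>_::nat. 0 :: real) \<subseteq> R" using R by auto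
  ultimately show ?thesis unfolding definable_in_def by blast
qed

theorem theorem1p3:
  fixes E :: "'v \<Rightarrow> 'v \<Rightarrow> bool" and V G :: "'v set" and r :: "nat \<Rightarrow> bool"
  assumes "wfp E" and "extensional_mem E"
    and "transitive_class E V" and "ZFC_model E V"
    and "cohen_real E V G r \<or> random_real E V G r"
    and "generic_extension E V G"
  shows "definable_in (reals_of E) {real n |n. r n} \<int>"
proof (rule Ints_definable)
  interpret transitive_ZFC_class E V using assms(1-4) by unfold_locales
  show "\<int> \<subseteq> reals_of E" by (rule Ints_subset_reals_of)
  have pos: "\<exists>i. r i \<and> r (i + n)" if "n > 0" for n
    using assms(5) cohen_shift random_shift that by blast
  show "\<exists>i. r i \<and> r (i + n)" for n
    using pos[of n] pos[of 1] by (cases n) auto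
qed

end
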